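(* Let $(\phi,\xi,\eta,g)$ be a contact metric structure on $M^{2n+1}$ satisfying the $(\kappa,\mu)$-nullity condition: there exist real constants $\kappa,\mu$ such that $$R(X,Y)\xi=(\kappa+\mu h)\,r(X,Y)\xi\quad\text{for all }X,Y\in TM,$$ where $h=\tfrac12L_\xi\phi$ and $r(u,v)w=g(v,w)u-g(u,w)v$. Then the contact metric structure is harmonic.
   Context: An almost contact metric structure on a Riemannian manifold $(M^{2n+1},g)$ consists of a $(1,1)$-tensor $\phi$, a unit vector field $\xi$ and its dual $1$-form $\eta=g(\xi,\cdot)$, with $\phi^2=-I+\eta\otimes\xi$ and $g(\phi X,\phi Y)=g(X,Y)-\eta(X)\eta(Y)$. It is a contact metric structure if $d\eta=\Phi$, where $\Phi(X,Y)=g(X,\phi Y)$ and $d\eta(X,Y)=\tfrac12\big(X\eta(Y)-Y\eta(X)-\eta([X,Y])\big)$. Everything is smooth. $L_\xi$ denotes the Lie derivative. $\nabla$ is the Levi-Civita connection; $\mathcal{D}=\operatorname{im}\phi=\ker\eta$; $J=\phi|_{\mathcal D}$; $\bar\nabla$ is the connection in $\mathcal{D}\to M$ given by $\bar\nabla_XY=(\nabla_XY)_{\mathcal D}$ (orthogonal projection), $X\in TM$, $Y$ a section of $\mathcal D$. $\nabla^2_{X,Y}=\nabla_X\nabla_Y-\nabla_{\nabla_XY}$ and $\bar\nabla^2_{X,Y}=\bar\nabla_X\bar\nabla_Y-\bar\nabla_{\nabla_XY}$. The Riemann curvature tensor is $R(X,Y)=\nabla^2_{X,Y}-\nabla^2_{Y,X}$.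 For a local orthonormal frame $(E_i)$ of $TM$ (sums over repeated indices): $\nabla^*\nabla\xi=-\nabla^2_{E_i,E_i}\xi$, $\bar\nabla^*\bar\nabla J=-\bar\nabla^2_{E_i,E_i}J$, and $$\tau(\xi)=\nabla^*\nabla\xi-|\nabla\xi|^2\xi,\quad \tau(J)=[\bar\nabla^*\bar\nabla J,J],\quad T(\phi)=(\bar\nabla_{E_i}J)\big(\nabla_{E_i}\xi\big),$$ where $[\cdot,\cdot]$ is the commutator of endomorphisms of $\mathcal D$ (note that $\nabla_X\xi\in\mathcal D$). The almost contact metric structure is harmonic if it is given by a harmonic section of the associated bundle with fibre $SO(2n+1)/U(n)$; equivalently (known result, used here as the definition), if both $\tau(\xi)+\tfrac12 J\,T(\phi)=0$ and $\tau(J)=0$ hold. *)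

theory Defs
  imports "HOL-Analysis.Analysis"
begin

section \<open>Smooth manifolds\<close>

primrec times_cont_diff_on ::
    "nat \<Rightarrow> ('e::euclidean_space \<Rightarrow> 'f::real_normed_vector) \<Rightarrow> 'e set \<Rightarrow> bool" where
  "times_cont_diff_on 0 f S = continuous_on S f"
| "times_cont_diff_on (Suc k) f S =
    ((\<forall>x\<in>S. f differentiable (at x)) \<and>
     (\<forall>v. times_cont_diff_on k (\<lambda>x. frechet_derivative f (at x) v) S))"

text \<open>Only meaningful for open sets.\<close>

definition smooth_on :: "'e set \<Rightarrow> ('e::euclidean_space \<Rightarrow> 'f::real_normed_vector) \<Rightarrow> bool" where
  "smooth_on S f \<longleftrightarrow> (\<forall>k. times_cont_diff_on k f S)"

text \<open>A chart is a pair of a domain and a coordinate map; the values of the coordinate map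
  outside the domain are irrelevant.\<close>

type_synonym ('a, 'e) chart = "'a set \<times> ('a \<Rightarrow> 'e)"

abbreviation dom_of :: "('a, 'e) chart \<Rightarrow> 'a set" where "dom_of c \<equiv> fst c"
abbreviation map_of_chart :: "('a, 'e) chart \<Rightarrow> 'a \<Rightarrow> 'e" where "map_of_chart c \<equiv> snd c"

definition chart_inv :: "('a, 'e) chart \<Rightarrow> 'e \<Rightarrow> 'a" where
  "chart_inv c = inv_into (dom_of c) (map_of_chart c)"

definition is_chart :: "('a::topological_space, 'e::euclidean_space) chart \<Rightarrow> bool" where
  "is_chart c \<longleftrightarrow> open (dom_of c) \<and> open (map_of_chart c ` dom_of c) \<and>
     homeomorphism (dom_of c) (map_of_chart c ` dom_of c) (map_of_chart c) (chart_inv c)"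

definition smooth_atlas :: "('a::topological_space, 'e::euclidean_space) chart set \<Rightarrow> bool" where
  "smooth_atlas A \<longleftrightarrow> (\<forall>c\<in>A. is_chart c) \<and>
     (\<forall>c\<in>A. \<forall>d\<in>A.
        smooth_on (map_of_chart c ` (dom_of c \<inter> dom_of d)) (map_of_chart d \<circ> chart_inv c))"

definition mcarrier :: "('a, 'e) chart set \<Rightarrow> 'a set" where
  "mcarrier A = (\<Union>c\<in>A. dom_of c)"

definition open_in_mfd :: "('a::topological_space, 'e) chart set \<Rightarrow> 'a set \<Rightarrow> bool" where
  "open_in_mfd A W \<longleftrightarrow> open W \<and> W \<subseteq> mcarrier A"

section \<open>Tangent vectors, functions and vector fields\<close>

text \<open>The tangent space at \<open>p\<close> is a copy of the model space: the vector \<open>v\<close> stands for the tangent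
  vector whose components in the chosen chart \<open>chart_at A p\<close> are \<open>v\<close>.  Its components in any other
  chart are obtained by the differential of the transition map.  A vector field on an open set \<open>W\<close>
  is a function \<open>'a \<Rightarrow> 'e\<close> of which only the values on \<open>W\<close> matter; it is smooth if its components
  in every chart are (as \<open>chart_at A p\<close> depends on \<open>p\<close> in an arbitrary way, this is not smoothness
  of the function itself).\<close>

definition chart_at :: "('a, 'e) chart set \<Rightarrow> 'a \<Rightarrow> ('a, 'e) chart" where
  "chart_at A p = (SOME c. c \<in> A \<and> p \<in> dom_of c)"

type_synonym ('a, 'e) vfield = "'a \<Rightarrow> 'e"

definition components ::
    "('a, 'e::euclidean_space) chart set \<Rightarrow> ('a, 'e) chart \<Rightarrow> ('a, 'e) vfield \<Rightarrow> 'e \<Rightarrow> 'e" where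
  "components A c X y =
     (let p = chart_inv c y; b = chart_at A p
      in frechet_derivative (map_of_chart c \<circ> chart_inv b) (at (map_of_chart b p)) (X p))"

definition smooth_fun ::
    "('a, 'e::euclidean_space) chart set \<Rightarrow> 'a set \<Rightarrow> ('a \<Rightarrow> real) \<Rightarrow> bool" where
  "smooth_fun A W f \<longleftrightarrow>
     (\<forall>c\<in>A. smooth_on (map_of_chart c ` (dom_of c \<inter> W)) (f \<circ> chart_inv c))"

definition smooth_vf ::
    "('a, 'e::euclidean_space) chart set \<Rightarrow> 'a set \<Rightarrow> ('a, 'e) vfield \<Rightarrow> bool" where
  "smooth_vf A W X \<longleftrightarrow>
     (\<forall>c\<in>A. smooth_on (map_of_chart c ` (dom_of c \<inter> W)) (components A c X))"

definition dir_deriv ::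
    "('a, 'e::euclidean_space) chart set \<Rightarrow> ('a, 'e) vfield \<Rightarrow> ('a \<Rightarrow> real) \<Rightarrow> 'a \<Rightarrow> real" where
  "dir_deriv A X f p =
     frechet_derivative (f \<circ> chart_inv (chart_at A p)) (at (map_of_chart (chart_at A p) p)) (X p)"

text \<open>In coordinates, \<open>[X, Y]\<^sup>i = X\<^sup>j \<partial>\<^sub>j Y\<^sup>i - Y\<^sup>j \<partial>\<^sub>j X\<^sup>i\<close>.\<close>

definition lie_bracket ::
    "('a, 'e::euclidean_space) chart set \<Rightarrow> ('a, 'e) vfield \<Rightarrow> ('a, 'e) vfield \<Rightarrow> ('a, 'e) vfield" where
  "lie_bracket A X Y p =
     (let c = chart_at A p
      in frechet_derivative (components A c Y) (at (map_of_chart c p)) (X p)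
       - frechet_derivative (components A c X) (at (map_of_chart c p)) (Y p))"

section \<open>Riemannian metrics and the Levi-Civita connection\<close>

definition riemannian_metric ::
    "('a::topological_space, 'e::euclidean_space) chart set \<Rightarrow> ('a \<Rightarrow> 'e \<Rightarrow> 'e \<Rightarrow> real) \<Rightarrow> bool" where
  "riemannian_metric A g \<longleftrightarrow>
     (\<forall>p\<in>mcarrier A. bilinear (g p) \<and> (\<forall>u v. g p u v = g p v u) \<and> (\<forall>v. v \<noteq> 0 \<longrightarrow> g p v v > 0)) \<and>
     (\<forall>W X Y. open_in_mfd A W \<longrightarrow> smooth_vf A W X \<longrightarrow> smooth_vf A W Y \<longrightarrow>
        smooth_fun A W (\<lambda>p. g p (X p) (Y p)))"

definition endo_field ::
    "('a::topological_space, 'e::euclidean_space) chart set \<Rightarrow> ('a \<Rightarrow> 'e \<Rightarrow> 'e) \<Rightarrow> bool" where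
  "endo_field A \<phi> \<longleftrightarrow>
     (\<forall>p\<in>mcarrier A. linear (\<phi> p)) \<and>
     (\<forall>W X. open_in_mfd A W \<longrightarrow> smooth_vf A W X \<longrightarrow> smooth_vf A W (\<lambda>p. \<phi> p (X p)))"

type_synonym ('a, 'e) conn = "('a, 'e) vfield \<Rightarrow> ('a, 'e) vfield \<Rightarrow> ('a, 'e) vfield"

text \<open>A connection acts on vector fields that are defined and smooth on some open set \<open>W\<close> only; the
  values on \<open>W\<close> of the result do not depend on the values of the arguments outside \<open>W\<close>.  (This
  follows from the axioms, by multiplying a field that vanishes on \<open>W\<close> with the function that is
  \<open>0\<close> on \<open>W\<close> and \<open>1\<close> elsewhere.)\<close>

definition connection ::
    "('a::topological_space, 'e::euclidean_space) chart set \<Rightarrow> ('a, 'e) conn \<Rightarrow> bool" where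
  "connection A nab \<longleftrightarrow>
     (\<forall>W. open_in_mfd A W \<longrightarrow>
       (\<forall>X Y. smooth_vf A W X \<longrightarrow> smooth_vf A W Y \<longrightarrow> smooth_vf A W (nab X Y)) \<and>
       (\<forall>X Y Z. smooth_vf A W X \<longrightarrow> smooth_vf A W Y \<longrightarrow> smooth_vf A W Z \<longrightarrow>
          (\<forall>p\<in>W. nab (\<lambda>q. X q + Y q) Z p = nab X Z p + nab Y Z p \<and>
                 nab X (\<lambda>q. Y q + Z q) p = nab X Y p + nab X Z p)) \<and>
       (\<forall>f X Y. smooth_fun A W f \<longrightarrow> smooth_vf A W X \<longrightarrow> smooth_vf A W Y \<longrightarrow>
          (\<forall>p\<in>W. nab (\<lambda>q. f q *\<^sub>R X q) Y p = f p *\<^sub>R nab X Y p \<and>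
                 nab X (\<lambda>q. f q *\<^sub>R Y q) p = dir_deriv A X f p *\<^sub>R Y p + f p *\<^sub>R nab X Y p)))"

definition levi_civita ::
    "('a::topological_space, 'e::euclidean_space) chart set \<Rightarrow> ('a \<Rightarrow> 'e \<Rightarrow> 'e \<Rightarrow> real) \<Rightarrow>
     ('a, 'e) conn \<Rightarrow> bool" where
  "levi_civita A g nab \<longleftrightarrow> connection A nab \<and>
     (\<forall>W X Y. open_in_mfd A W \<longrightarrow> smooth_vf A W X \<longrightarrow> smooth_vf A W Y \<longrightarrow>
        (\<forall>p\<in>W. nab X Y p - nab Y X p = lie_bracket A X Y p)) \<and>
     (\<forall>W X Y Z. open_in_mfd A W \<longrightarrow> smooth_vf A W X \<longrightarrow> smooth_vf A W Y \<longrightarrow> smooth_vf A W Z \<longrightarrow>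
        (\<forall>p\<in>W. dir_deriv A X (\<lambda>q. g q (Y q) (Z q)) p =
               g p (nab X Y p) (Z p) + g p (Y p) (nab X Z p)))"

definition nab2 :: "('a, 'e::euclidean_space) conn \<Rightarrow>
    ('a, 'e) vfield \<Rightarrow> ('a, 'e) vfield \<Rightarrow> ('a, 'e) vfield \<Rightarrow> ('a, 'e) vfield" where
  "nab2 nab X Y Z = (\<lambda>p. nab X (nab Y Z) p - nab (nab X Y) Z p)"

definition curvature :: "('a, 'e::euclidean_space) conn \<Rightarrow>
    ('a, 'e) vfield \<Rightarrow> ('a, 'e) vfield \<Rightarrow> ('a, 'e) vfield \<Rightarrow> ('a, 'e) vfield" where
  "curvature nab X Y Z = (\<lambda>p. nab2 nab X Y Z p - nab2 nab Y X Z p)"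

definition orthonormal_frame ::
    "('a, 'e::euclidean_space) chart set \<Rightarrow> ('a \<Rightarrow> 'e \<Rightarrow> 'e \<Rightarrow> real) \<Rightarrow> 'a set \<Rightarrow>
     (nat \<Rightarrow> ('a, 'e) vfield) \<Rightarrow> bool" where
  "orthonormal_frame A g W E \<longleftrightarrow>
     (\<forall>i<DIM('e). smooth_vf A W (E i)) \<and>
     (\<forall>p\<in>W. \<forall>i<DIM('e). \<forall>j<DIM('e). g p (E i p) (E j p) = (if i = j then 1 else 0))"

section \<open>Contact metric structures\<close>

definition almost_contact_metric ::
    "('a::topological_space, 'e::euclidean_space) chart set \<Rightarrow> ('a \<Rightarrow> 'e \<Rightarrow> 'e) \<Rightarrow>
     ('a, 'e) vfield \<Rightarrow> ('a \<Rightarrow> 'e \<Rightarrow> real) \<Rightarrow> ('a \<Rightarrow> 'e \<Rightarrow> 'e \<Rightarrow> real) \<Rightarrow> bool" where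
  "almost_contact_metric A \<phi> \<xi> \<eta> g \<longleftrightarrow>
     riemannian_metric A g \<and> endo_field A \<phi> \<and> smooth_vf A (mcarrier A) \<xi> \<and>
     (\<forall>p\<in>mcarrier A.
        g p (\<xi> p) (\<xi> p) = 1 \<and>
        (\<forall>v. \<eta> p v = g p (\<xi> p) v) \<and>
        (\<forall>v. \<phi> p (\<phi> p v) = - v + \<eta> p v *\<^sub>R \<xi> p) \<and>
        (\<forall>u v. g p (\<phi> p u) (\<phi> p v) = g p u v - \<eta> p u * \<eta> p v))"

definition ext_deriv ::
    "('a, 'e::euclidean_space) chart set \<Rightarrow> ('a \<Rightarrow> 'e \<Rightarrow> real) \<Rightarrow>
     ('a, 'e) vfield \<Rightarrow> ('a, 'e) vfield \<Rightarrow> 'a \<Rightarrow> real" where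
  "ext_deriv A \<eta> X Y p =
     (1/2) * (dir_deriv A X (\<lambda>q. \<eta> q (Y q)) p - dir_deriv A Y (\<lambda>q. \<eta> q (X q)) p
              - \<eta> p (lie_bracket A X Y p))"

definition contact_metric ::
    "('a::topological_space, 'e::euclidean_space) chart set \<Rightarrow> ('a \<Rightarrow> 'e \<Rightarrow> 'e) \<Rightarrow>
     ('a, 'e) vfield \<Rightarrow> ('a \<Rightarrow> 'e \<Rightarrow> real) \<Rightarrow> ('a \<Rightarrow> 'e \<Rightarrow> 'e \<Rightarrow> real) \<Rightarrow> bool" where
  "contact_metric A \<phi> \<xi> \<eta> g \<longleftrightarrow> almost_contact_metric A \<phi> \<xi> \<eta> g \<and>
     (\<forall>W X Y. open_in_mfd A W \<longrightarrow> smooth_vf A W X \<longrightarrow> smooth_vf A W Y \<longrightarrow>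
        (\<forall>p\<in>W. ext_deriv A \<eta> X Y p = g p (X p) (\<phi> p (Y p))))"

definition lie_deriv_endo ::
    "('a, 'e::euclidean_space) chart set \<Rightarrow> ('a, 'e) vfield \<Rightarrow> ('a \<Rightarrow> 'e \<Rightarrow> 'e) \<Rightarrow>
     ('a, 'e) vfield \<Rightarrow> ('a, 'e) vfield" where
  "lie_deriv_endo A \<xi> \<phi> X =
     (\<lambda>p. lie_bracket A \<xi> (\<lambda>q. \<phi> q (X q)) p - \<phi> p (lie_bracket A \<xi> X p))"

definition h_field ::
    "('a, 'e::euclidean_space) chart set \<Rightarrow> ('a \<Rightarrow> 'e \<Rightarrow> 'e) \<Rightarrow> ('a, 'e) vfield \<Rightarrow>
     ('a, 'e) vfield \<Rightarrow> ('a, 'e) vfield" where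
  "h_field A \<phi> \<xi> X = (\<lambda>p. (1/2) *\<^sub>R lie_deriv_endo A \<xi> \<phi> X p)"

definition r_field :: "('a \<Rightarrow> 'e \<Rightarrow> 'e \<Rightarrow> real) \<Rightarrow>
    ('a, 'e::euclidean_space) vfield \<Rightarrow> ('a, 'e) vfield \<Rightarrow> ('a, 'e) vfield \<Rightarrow> ('a, 'e) vfield" where
  "r_field g X Y Z = (\<lambda>p. g p (Y p) (Z p) *\<^sub>R X p - g p (X p) (Z p) *\<^sub>R Y p)"

definition nullity_condition ::
    "('a::topological_space, 'e::euclidean_space) chart set \<Rightarrow> ('a \<Rightarrow> 'e \<Rightarrow> 'e) \<Rightarrow>
     ('a, 'e) vfield \<Rightarrow> ('a \<Rightarrow> 'e \<Rightarrow> 'e \<Rightarrow> real) \<Rightarrow> ('a, 'e) conn \<Rightarrow> real \<Rightarrow> real \<Rightarrow> bool" where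
  "nullity_condition A \<phi> \<xi> g nab \<kappa> \<mu> \<longleftrightarrow>
     (\<forall>W X Y. open_in_mfd A W \<longrightarrow> smooth_vf A W X \<longrightarrow> smooth_vf A W Y \<longrightarrow>
        (\<forall>p\<in>W. curvature nab X Y \<xi> p =
               \<kappa> *\<^sub>R r_field g X Y \<xi> p + \<mu> *\<^sub>R h_field A \<phi> \<xi> (r_field g X Y \<xi>) p))"

section \<open>Harmonicity\<close>

text \<open>Sections of \<open>\<D> = ker \<eta>\<close> are vector fields with values in \<open>\<D>\<close>.  A field of endomorphisms
  of \<open>\<D>\<close> is given by the operator it induces on sections of \<open>\<D>\<close>, so that \<open>nab_bar_endo \<xi> \<eta> nab X B Y\<close>
  is the derivative of \<open>B\<close> in the direction \<open>X\<close>, applied to the section \<open>Y\<close>.\<close>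

definition smooth_section_D ::
    "('a, 'e::euclidean_space) chart set \<Rightarrow> ('a \<Rightarrow> 'e \<Rightarrow> real) \<Rightarrow> 'a set \<Rightarrow> ('a, 'e) vfield \<Rightarrow> bool" where
  "smooth_section_D A \<eta> W Y \<longleftrightarrow> smooth_vf A W Y \<and> (\<forall>p\<in>W. \<eta> p (Y p) = 0)"

text \<open>Orthogonal projection onto \<open>\<D>\<close>, the orthogonal complement of the unit vector field \<open>\<xi>\<close>.\<close>

definition proj_D :: "('a, 'e::euclidean_space) vfield \<Rightarrow> ('a \<Rightarrow> 'e \<Rightarrow> real) \<Rightarrow> 'a \<Rightarrow> 'e \<Rightarrow> 'e" where
  "proj_D \<xi> \<eta> p v = v - \<eta> p v *\<^sub>R \<xi> p"

definition nab_bar :: "('a, 'e::euclidean_space) vfield \<Rightarrow> ('a \<Rightarrow> 'e \<Rightarrow> real) \<Rightarrow>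
    ('a, 'e) conn \<Rightarrow> ('a, 'e) conn" where
  "nab_bar \<xi> \<eta> nab X Y = (\<lambda>p. proj_D \<xi> \<eta> p (nab X Y p))"

definition J_op :: "('a \<Rightarrow> 'e \<Rightarrow> 'e) \<Rightarrow> ('a, 'e) vfield \<Rightarrow> ('a, 'e) vfield" where
  "J_op \<phi> Y = (\<lambda>p. \<phi> p (Y p))"

definition nab_bar_endo :: "('a, 'e::euclidean_space) vfield \<Rightarrow> ('a \<Rightarrow> 'e \<Rightarrow> real) \<Rightarrow>
    ('a, 'e) conn \<Rightarrow> ('a, 'e) vfield \<Rightarrow> (('a, 'e) vfield \<Rightarrow> ('a, 'e) vfield) \<Rightarrow>
    ('a, 'e) vfield \<Rightarrow> ('a, 'e) vfield" where
  "nab_bar_endo \<xi> \<eta> nab X B Y =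
     (\<lambda>p. nab_bar \<xi> \<eta> nab X (B Y) p - B (nab_bar \<xi> \<eta> nab X Y) p)"

definition nab_bar2_endo :: "('a, 'e::euclidean_space) vfield \<Rightarrow> ('a \<Rightarrow> 'e \<Rightarrow> real) \<Rightarrow>
    ('a, 'e) conn \<Rightarrow> ('a, 'e) vfield \<Rightarrow> ('a, 'e) vfield \<Rightarrow>
    (('a, 'e) vfield \<Rightarrow> ('a, 'e) vfield) \<Rightarrow> ('a, 'e) vfield \<Rightarrow> ('a, 'e) vfield" where
  "nab_bar2_endo \<xi> \<eta> nab X Y B Z =
     (\<lambda>p. nab_bar_endo \<xi> \<eta> nab X (nab_bar_endo \<xi> \<eta> nab Y B) Z p
        - nab_bar_endo \<xi> \<eta> nab (nab X Y) B Z p)"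

text \<open>In the following definitions \<open>E\<close> is a local orthonormal frame.\<close>

definition rough_laplacian_xi :: "(nat \<Rightarrow> ('a, 'e::euclidean_space) vfield) \<Rightarrow>
    ('a, 'e) conn \<Rightarrow> ('a, 'e) vfield \<Rightarrow> ('a, 'e) vfield" where
  "rough_laplacian_xi E nab \<xi> = (\<lambda>p. - (\<Sum>i<DIM('e). nab2 nab (E i) (E i) \<xi> p))"

definition norm_sq_nab_xi :: "(nat \<Rightarrow> ('a, 'e::euclidean_space) vfield) \<Rightarrow>
    ('a \<Rightarrow> 'e \<Rightarrow> 'e \<Rightarrow> real) \<Rightarrow> ('a, 'e) conn \<Rightarrow> ('a, 'e) vfield \<Rightarrow> 'a \<Rightarrow> real" where
  "norm_sq_nab_xi E g nab \<xi> p = (\<Sum>i<DIM('e). g p (nab (E i) \<xi> p) (nab (E i) \<xi> p))"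

definition tau_xi :: "(nat \<Rightarrow> ('a, 'e::euclidean_space) vfield) \<Rightarrow>
    ('a \<Rightarrow> 'e \<Rightarrow> 'e \<Rightarrow> real) \<Rightarrow> ('a, 'e) conn \<Rightarrow> ('a, 'e) vfield \<Rightarrow> ('a, 'e) vfield" where
  "tau_xi E g nab \<xi> = (\<lambda>p. rough_laplacian_xi E nab \<xi> p - norm_sq_nab_xi E g nab \<xi> p *\<^sub>R \<xi> p)"

definition rough_laplacian_J :: "(nat \<Rightarrow> ('a, 'e::euclidean_space) vfield) \<Rightarrow>
    ('a \<Rightarrow> 'e \<Rightarrow> 'e) \<Rightarrow> ('a, 'e) vfield \<Rightarrow> ('a \<Rightarrow> 'e \<Rightarrow> real) \<Rightarrow> ('a, 'e) conn \<Rightarrow>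
    ('a, 'e) vfield \<Rightarrow> ('a, 'e) vfield" where
  "rough_laplacian_J E \<phi> \<xi> \<eta> nab Y =
     (\<lambda>p. - (\<Sum>i<DIM('e). nab_bar2_endo \<xi> \<eta> nab (E i) (E i) (J_op \<phi>) Y p))"

definition tau_J :: "(nat \<Rightarrow> ('a, 'e::euclidean_space) vfield) \<Rightarrow>
    ('a \<Rightarrow> 'e \<Rightarrow> 'e) \<Rightarrow> ('a, 'e) vfield \<Rightarrow> ('a \<Rightarrow> 'e \<Rightarrow> real) \<Rightarrow> ('a, 'e) conn \<Rightarrow>
    ('a, 'e) vfield \<Rightarrow> ('a, 'e) vfield" where
  "tau_J E \<phi> \<xi> \<eta> nab Y =
     (\<lambda>p. rough_laplacian_J E \<phi> \<xi> \<eta> nab (J_op \<phi> Y) p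
        - J_op \<phi> (rough_laplacian_J E \<phi> \<xi> \<eta> nab Y) p)"

definition T_phi :: "(nat \<Rightarrow> ('a, 'e::euclidean_space) vfield) \<Rightarrow>
    ('a \<Rightarrow> 'e \<Rightarrow> 'e) \<Rightarrow> ('a, 'e) vfield \<Rightarrow> ('a \<Rightarrow> 'e \<Rightarrow> real) \<Rightarrow> ('a, 'e) conn \<Rightarrow>
    ('a, 'e) vfield" where
  "T_phi E \<phi> \<xi> \<eta> nab =
     (\<lambda>p. \<Sum>i<DIM('e). nab_bar_endo \<xi> \<eta> nab (E i) (J_op \<phi>) (nab (E i) \<xi>) p)"

text \<open>The traces do not depend on the local orthonormal frame, and such frames exist around every
  point; the equations are required for all of them.\<close>

definition harmonic_structure ::
    "('a::topological_space, 'e::euclidean_space) chart set \<Rightarrow> ('a \<Rightarrow> 'e \<Rightarrow> 'e) \<Rightarrow>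
     ('a, 'e) vfield \<Rightarrow> ('a \<Rightarrow> 'e \<Rightarrow> real) \<Rightarrow> ('a \<Rightarrow> 'e \<Rightarrow> 'e \<Rightarrow> real) \<Rightarrow> ('a, 'e) conn \<Rightarrow> bool" where
  "harmonic_structure A \<phi> \<xi> \<eta> g nab \<longleftrightarrow>
     (\<forall>W E. open_in_mfd A W \<longrightarrow> orthonormal_frame A g W E \<longrightarrow>
        (\<forall>p\<in>W. tau_xi E g nab \<xi> p + (1/2) *\<^sub>R J_op \<phi> (T_phi E \<phi> \<xi> \<eta> nab) p = 0) \<and>
        (\<forall>Y. smooth_section_D A \<eta> W Y \<longrightarrow> (\<forall>p\<in>W. tau_J E \<phi> \<xi> \<eta> nab Y p = 0)))"

end

theory Submission
  imports Defs
begin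

text \<open>Write \<open>\<nabla>\<xi> = \<sigma> - \<phi>\<close> with \<open>\<sigma>\<close> symmetric.  Since \<open>d\<Phi> = d(d\<eta>) = 0\<close>, we have \<open>\<nabla>\<^sub>\<xi> \<phi> = 0\<close>, \<open>\<sigma>\<close>
  anticommutes with \<open>\<phi>\<close>, and \<open>h = \<phi>\<sigma>\<close>.  The value of \<open>R(X, \<xi>)\<xi>\<close> given by the nullity condition
  yields \<open>h\<^sup>2 = (1 - \<kappa>) I\<close> on \<open>\<D>\<close>, whereas \<open>R(X, Y)\<xi> = 0\<close> for \<open>X, Y \<in> \<D>\<close> is a Codazzi equation for
  \<open>\<sigma> - \<phi>\<close>; combined with the derivative of \<open>\<phi>\<sigma> + \<sigma>\<phi> = 0\<close> it shows that the \<open>\<D>\<close>-part of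
  \<open>(\<nabla>\<^sub>X \<phi>)Y\<close> vanishes for \<open>X\<close> in the image of \<open>h\<close> and \<open>Y \<in> \<D>\<close>.  If \<open>\<kappa> \<noteq> 1\<close> then \<open>h\<close> is invertible
  on \<open>\<D>\<close>, and if \<open>\<kappa> = 1\<close> then \<open>\<sigma> = 0\<close> and the Codazzi equation suffices; in both cases \<open>J\<close> is
  parallel, so that \<open>\<tau>(J)\<close> and \<open>T(\<phi>)\<close> vanish.  Finally \<open>\<nabla>\<sigma>\<close>, restricted to \<open>\<D>\<close>, changes sign when
  \<open>J\<close> is applied to both arguments, so its trace is a multiple of \<open>\<xi>\<close> and \<open>\<tau>(\<xi>) = 0\<close>.\<close>

section \<open>Calculus of smooth functions\<close>

lemma times_cont_diff_on_cong:
  assumes "open S" "\<And>x. x \<in> S \<Longrightarrow> f x = f' x" "times_cont_diff_on k f S"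
  shows "times_cont_diff_on k f' S"
  using assms(2,3)
proof (induction k arbitrary: f f')
  case 0
  then show ?case using continuous_on_cong[of S S f f'] by simp
next
  case (Suc k)
  have eq: "frechet_derivative f (at x) = frechet_derivative f' (at x)" if "x \<in> S" for x
    using that Suc.prems assms(1) by (intro frechet_derivative_transform_within_open) auto
  have "f' differentiable (at x)" if "x \<in> S" for x
    using that Suc.prems assms(1)
    by (metis (no_types, lifting) differentiable_def has_derivative_transform_within_open times_cont_diff_on.simps(2))
  moreover have "times_cont_diff_on k (\<lambda>x. frechet_derivative f' (at x) v) S" for v
    using Suc.IH[of "\<lambda>x. frechet_derivative f (at x) v"] Suc.prems(2) eq by simp
  ultimately show ?case by simp
qed

lemma times_cont_diff_on_subset:
  "times_cont_diff_on k f S \<Longrightarrow> T \<subseteq> S \<Longrightarrow> times_cont_diff_on k f T"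
  by (induction k arbitrary: f) (auto intro: continuous_on_subset)

lemma times_cont_diff_on_Suc: "times_cont_diff_on (Suc k) f S \<Longrightarrow> times_cont_diff_on k f S"
proof (induction k arbitrary: f)
  case 0
  then show ?case
    by (auto intro!: continuous_at_imp_continuous_on differentiable_imp_continuous_within)
qed auto

lemma times_cont_diff_on_const: "times_cont_diff_on k (\<lambda>x. c) S"
  by (induction k arbitrary: c) auto

lemma times_cont_diff_on_add:
  assumes "open S" "times_cont_diff_on k f S" "times_cont_diff_on k f' S"
  shows "times_cont_diff_on k (\<lambda>x. f x + f' x) S"
  using assms(2,3)
proof (induction k arbitrary: f f')
  case 0
  then show ?case by (simp add: continuous_on_add)
next
  case (Suc k)
  have eq: "frechet_derivative f (at x) v + frechet_derivative f' (at x) v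
      = frechet_derivative (\<lambda>x. f x + f' x) (at x) v" if "x \<in> S" for x v
    using that Suc.prems
    by (intro fun_cong[OF frechet_derivative_at[OF has_derivative_add]])
      (auto simp: frechet_derivative_works)
  show ?case
    using Suc times_cont_diff_on_cong[OF assms(1) eq] by (simp add: differentiable_add)
qed

lemma times_cont_diff_on_scaleR:
  assumes "open S" "times_cont_diff_on k f S" "times_cont_diff_on k F S"
  shows "times_cont_diff_on k (\<lambda>x. f x *\<^sub>R F x) S"
  using assms(2,3)
proof (induction k arbitrary: f F)
  case 0
  then show ?case by (simp add: continuous_on_scaleR)
next
  case (Suc k)
  have der: "((\<lambda>x. f x *\<^sub>R F x) has_derivative
      (\<lambda>v. f x *\<^sub>R frechet_derivative F (at x) v + frechet_derivative f (at x) v *\<^sub>R F x)) (at x)"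
    if "x \<in> S" for x
    using that Suc.prems by (intro has_derivative_scaleR) (auto simp: frechet_derivative_works)
  have eq: "f x *\<^sub>R frechet_derivative F (at x) v + frechet_derivative f (at x) v *\<^sub>R F x
      = frechet_derivative (\<lambda>x. f x *\<^sub>R F x) (at x) v" if "x \<in> S" for x v
    by (rule fun_cong[OF frechet_derivative_at[OF der[OF that]]])
  have "times_cont_diff_on k (\<lambda>x. f x *\<^sub>R frechet_derivative F (at x) v +
      frechet_derivative f (at x) v *\<^sub>R F x) S" for v
    using Suc.prems times_cont_diff_on_Suc[OF Suc.prems(1)] times_cont_diff_on_Suc[OF Suc.prems(2)]
    by (intro times_cont_diff_on_add assms Suc.IH) auto
  then show ?case
    using times_cont_diff_on_cong[OF assms(1) eq] differentiableI[OF der] by simp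
qed

lemma times_cont_diff_on_sum:
  assumes "open S" "\<And>i. i \<in> I \<Longrightarrow> times_cont_diff_on k (f i) S"
  shows "times_cont_diff_on k (\<lambda>x. \<Sum>i\<in>I. f i x) S"
  using assms(2)
  by (induction I rule: infinite_finite_induct)
    (auto intro!: times_cont_diff_on_add times_cont_diff_on_const assms(1))

lemma times_cont_diff_on_bounded_linear:
  assumes "open S" "times_cont_diff_on k f S" "bounded_linear L"
  shows "times_cont_diff_on k (\<lambda>x. L (f x)) S"
  using assms(2)
proof (induction k arbitrary: f)
  case 0
  then show ?case by (simp add: bounded_linear.continuous_on[OF assms(3)])
next
  case (Suc k)
  have der: "((\<lambda>x. L (f x)) has_derivative (\<lambda>v. L (frechet_derivative f (at x) v))) (at x)"
    if "x \<in> S" for x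
    using that Suc.prems by (intro bounded_linear.has_derivative[OF assms(3)])
      (auto simp: frechet_derivative_works)
  have eq: "L (frechet_derivative f (at x) v) = frechet_derivative (\<lambda>x. L (f x)) (at x) v"
    if "x \<in> S" for x v
    by (rule fun_cong[OF frechet_derivative_at[OF der[OF that]]])
  show ?case
    using Suc times_cont_diff_on_cong[OF assms(1) eq] differentiableI[OF der] by simp
qed

text \<open>The definition controls derivatives in fixed directions, whereas the chain rule
  evaluates the derivative of \<open>f\<close> in the direction
  \<open>frechet_derivative h (at x) v\<close>, which varies with \<open>x\<close>. Expanding this
  direction in \<open>Basis\<close> leaves products of scalar coefficients with
  \<open>frechet_derivative f (at (h x)) b\<close>, to which the induction hypothesis
  applies.\<close>

lemma times_cont_diff_on_compose:
  fixes f :: "'f::euclidean_space \<Rightarrow> 'g::real_normed_vector" and h :: "'e::euclidean_space \<Rightarrow> 'f"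
  assumes "open S" "open T" "times_cont_diff_on k h S" "times_cont_diff_on k f T" "h ` S \<subseteq> T"
  shows "times_cont_diff_on k (\<lambda>x. f (h x)) S"
  using assms(3,4)
proof (induction k arbitrary: f)
  case 0
  then show ?case using assms(5) continuous_on_compose2[of T f S h] by simp
next
  case (Suc k)
  have der: "((\<lambda>x. f (h x)) has_derivative
      (\<lambda>v. frechet_derivative f (at (h x)) (frechet_derivative h (at x) v))) (at x)"
    if "x \<in> S" for x
    using that Suc.prems assms(5)
    by (intro has_derivative_compose[where f=h and g=f]) (auto simp: frechet_derivative_works)
  have eq: "(\<Sum>b\<in>Basis. (frechet_derivative h (at x) v \<bullet> b) *\<^sub>R frechet_derivative f (at (h x)) b)
      = frechet_derivative (\<lambda>x. f (h x)) (at x) v" if "x \<in> S" for x v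
  proof -
    have lin: "linear (frechet_derivative f (at (h x)))"
      using that assms(5) Suc.prems by (intro linear_frechet_derivative) auto
    have "frechet_derivative (\<lambda>x. f (h x)) (at x) v =
        frechet_derivative f (at (h x)) (frechet_derivative h (at x) v)"
      using fun_cong[OF frechet_derivative_at[OF der[OF that]]] by simp
    also have "\<dots> = frechet_derivative f (at (h x))
        (\<Sum>b\<in>Basis. (frechet_derivative h (at x) v \<bullet> b) *\<^sub>R b)"
      by (simp add: euclidean_representation)
    finally show ?thesis by (simp add: linear_sum[OF lin] linear_scale[OF lin])
  qed
  have "times_cont_diff_on k (\<lambda>x. \<Sum>b\<in>Basis. (frechet_derivative h (at x) v \<bullet> b) *\<^sub>R
      frechet_derivative f (at (h x)) b) S" for v
    using Suc.prems times_cont_diff_on_Suc[OF Suc.prems(1)]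
    by (intro times_cont_diff_on_sum times_cont_diff_on_scaleR assms(1) Suc.IH
        times_cont_diff_on_bounded_linear[OF assms(1) _ bounded_linear_inner_left]) auto
  then show ?case
    using times_cont_diff_on_cong[OF assms(1) eq] differentiableI[OF der] by simp
qed

lemma smooth_on_cong: "open S \<Longrightarrow> (\<And>x. x \<in> S \<Longrightarrow> f x = f' x) \<Longrightarrow> smooth_on S f \<Longrightarrow> smooth_on S f'"
  using times_cont_diff_on_cong unfolding smooth_on_def by blast

lemma smooth_on_subset: "smooth_on S f \<Longrightarrow> T \<subseteq> S \<Longrightarrow> smooth_on T f"
  using times_cont_diff_on_subset unfolding smooth_on_def by blast

lemma smooth_on_const: "smooth_on S (\<lambda>x. c)"
  by (simp add: smooth_on_def times_cont_diff_on_const)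

lemma smooth_on_add:
  "open S \<Longrightarrow> smooth_on S f \<Longrightarrow> smooth_on S f' \<Longrightarrow> smooth_on S (\<lambda>x. f x + f' x)"
  by (simp add: smooth_on_def times_cont_diff_on_add)

lemma smooth_on_scaleR:
  "open S \<Longrightarrow> smooth_on S f \<Longrightarrow> smooth_on S F \<Longrightarrow> smooth_on S (\<lambda>x. f x *\<^sub>R F x)"
  by (simp add: smooth_on_def times_cont_diff_on_scaleR)

lemma smooth_on_compose:
  "open S \<Longrightarrow> open T \<Longrightarrow> smooth_on S h \<Longrightarrow> smooth_on T f \<Longrightarrow> h ` S \<subseteq> T \<Longrightarrow> smooth_on S (\<lambda>x. f (h x))"
  unfolding smooth_on_def using times_cont_diff_on_compose by blast

lemma smooth_on_differentiable: "smooth_on S f \<Longrightarrow> x \<in> S \<Longrightarrow> f differentiable (at x)"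
  unfolding smooth_on_def by (metis times_cont_diff_on.simps(2))

lemma smooth_on_frechet_derivative:
  "smooth_on S f \<Longrightarrow> smooth_on S (\<lambda>x. frechet_derivative f (at x) v)"
  unfolding smooth_on_def by (metis times_cont_diff_on.simps(2))

lemma smooth_on_continuous_on: "smooth_on S f \<Longrightarrow> continuous_on S f"
  unfolding smooth_on_def by (metis times_cont_diff_on.simps(1))

text \<open>Schwarz's theorem: the second difference quotient of \<open>f\<close> is symmetric in \<open>u\<close> and \<open>v\<close>, and by
  two applications of the mean value theorem it converges to the iterated derivative.\<close>

lemma second_difference_tendsto:
  fixes f :: "'e::euclidean_space \<Rightarrow> real"
  assumes S: "open S" "x \<in> S" and f: "smooth_on S f"
  shows "((\<lambda>t. (f (x + t *\<^sub>R u + t *\<^sub>R v) - f (x + t *\<^sub>R u) - f (x + t *\<^sub>R v) + f x) / t\<^sup>2) \<longlongrightarrow>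
    frechet_derivative (\<lambda>y. frechet_derivative f (at y) u) (at x) v) (at_right 0)"
proof -
  define g where "g y = frechet_derivative (\<lambda>y. frechet_derivative f (at y) u) (at y) v" for y
  have smg: "smooth_on S g"
    unfolding g_def using f by (intro smooth_on_frechet_derivative)
  have sm1: "smooth_on S (\<lambda>y. frechet_derivative f (at y) u)"
    using f by (intro smooth_on_frechet_derivative)
  have line: "((\<lambda>r. k (y + r *\<^sub>R w)) has_field_derivative frechet_derivative k (at (y + r *\<^sub>R w)) w) (at r)"
    if k: "smooth_on S k" and y: "y + r *\<^sub>R w \<in> S" for k :: "'e \<Rightarrow> real" and y w r
  proof -
    have d: "(k has_derivative frechet_derivative k (at (y + r *\<^sub>R w))) (at (y + r *\<^sub>R w))"
      using smooth_on_differentiable[OF k y] by (simp add: frechet_derivative_works)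
    have "((\<lambda>r. k (y + r *\<^sub>R w)) has_derivative (\<lambda>h. frechet_derivative k (at (y + r *\<^sub>R w)) (h *\<^sub>R w))) (at r)"
      by (rule has_derivative_compose[where f="\<lambda>r. y + r *\<^sub>R w" and g=k, OF _ d])
        (auto intro!: derivative_eq_intros)
    then show ?thesis
      using linear_scale[OF has_derivative_linear[OF d]]
      by (simp add: has_field_derivative_def mult.commute[of _ "frechet_derivative k (at (y + r *\<^sub>R w)) w"])
  qed
  show ?thesis
  proof (rule tendstoI)
    fix e :: real assume "e > 0"
    have "isCont g x"
      using smooth_on_continuous_on[OF smg] S by (simp add: continuous_on_eq_continuous_at)
    then obtain d0 where d0: "d0 > 0" "\<And>y. dist y x < d0 \<Longrightarrow> dist (g y) (g x) < e"
      using \<open>e > 0\<close> unfolding continuous_at_eps_delta by metis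
    obtain d1 where d1: "d1 > 0" "ball x d1 \<subseteq> S"
      using S openE by blast
    define d where "d = min d0 d1"
    \<comment> \<open>For \<open>t < \<delta>\<close> the parallelogram at \<open>x\<close> with
      sides \<open>t *\<^sub>R u\<close> and \<open>t *\<^sub>R v\<close> stays within distance
      \<open>d\<close> of \<open>x\<close>; the summand 1 covers the case u = v = 0.\<close>
    define \<delta> where "\<delta> = d / (norm u + norm v + 1)"
    have pos: "norm u + norm v + 1 > 0" by (simp add: add_nonneg_pos)
    have "d > 0" "\<delta> > 0" using d0 d1 pos by (auto simp: d_def \<delta>_def)
    have near: "dist (x + r *\<^sub>R u + s *\<^sub>R v) x < d"
      if "0 \<le> r" "r \<le> t" "0 \<le> s" "s \<le> t" "t < \<delta>" for r s t
    proof -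
      have "dist (x + r *\<^sub>R u + s *\<^sub>R v) x = norm (r *\<^sub>R u + s *\<^sub>R v)"
        by (simp add: dist_norm algebra_simps)
      also have "\<dots> \<le> norm (r *\<^sub>R u) + norm (s *\<^sub>R v)" by (rule norm_triangle_ineq)
      also have "\<dots> \<le> t * norm u + t * norm v"
        using that by (intro add_mono) (simp_all add: mult_right_mono)
      also have "\<dots> \<le> t * (norm u + norm v + 1)" using that by (simp add: algebra_simps)
      also have "\<dots> < d" using that(5) pos by (simp add: \<delta>_def pos_less_divide_eq)
      finally show ?thesis .
    qed
    have inS: "x + r *\<^sub>R u + s *\<^sub>R v \<in> S"
      if "0 \<le> r" "r \<le> t" "0 \<le> s" "s \<le> t" "t < \<delta>" for r s t
      using near[OF that] d1 by (auto simp: d_def dist_commute mem_ball subset_iff)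
    have main: "dist ((f (x + t *\<^sub>R u + t *\<^sub>R v) - f (x + t *\<^sub>R u) - f (x + t *\<^sub>R v) + f x) / t\<^sup>2) (g x) < e"
      if t: "0 < t" "t < \<delta>" for t
    proof -
      \<comment> \<open>The second difference is \<open>F t - F 0\<close>. The mean value theorem is
        applied first to \<open>F\<close>, which yields \<open>r\<close>, and then in the direction
        \<open>v\<close> to the derivative of \<open>f\<close> along \<open>u\<close>, which yields
        \<open>s\<close>.\<close>
      define F where "F r = f ((x + t *\<^sub>R v) + r *\<^sub>R u) - f (x + r *\<^sub>R u)" for r
      have "\<exists>r. 0 < r \<and> r < t \<and> F t - F 0 = (t - 0) *
          (frechet_derivative f (at ((x + t *\<^sub>R v) + r *\<^sub>R u)) u - frechet_derivative f (at (x + r *\<^sub>R u)) u)"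
      proof (rule MVT2)
        fix r assume "0 \<le> r" "r \<le> t"
        then show "(F has_real_derivative frechet_derivative f (at ((x + t *\<^sub>R v) + r *\<^sub>R u)) u
            - frechet_derivative f (at (x + r *\<^sub>R u)) u) (at r)"
          unfolding F_def using inS[of r t t] inS[of r t 0] t
          by (intro DERIV_diff line[OF f]) (simp_all add: algebra_simps)
      qed (use t in simp)
      then obtain r where r: "0 < r" "r < t" and Fr: "F t - F 0 = t *
          (frechet_derivative f (at ((x + r *\<^sub>R u) + t *\<^sub>R v)) u - frechet_derivative f (at ((x + r *\<^sub>R u) + 0 *\<^sub>R v)) u)"
        by (auto simp: algebra_simps)
      have "\<exists>s. 0 < s \<and> s < t \<and> frechet_derivative f (at ((x + r *\<^sub>R u) + t *\<^sub>R v)) u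
          - frechet_derivative f (at ((x + r *\<^sub>R u) + 0 *\<^sub>R v)) u = (t - 0) * g ((x + r *\<^sub>R u) + s *\<^sub>R v)"
      proof (rule MVT2)
        fix s assume "0 \<le> s" "s \<le> t"
        then show "((\<lambda>s. frechet_derivative f (at ((x + r *\<^sub>R u) + s *\<^sub>R v)) u) has_real_derivative
            g ((x + r *\<^sub>R u) + s *\<^sub>R v)) (at s)"
          unfolding g_def using inS[of r t s] t r by (intro line[OF sm1]) simp
      qed (use t in simp)
      then obtain s where s: "0 < s" "s < t" and "F t - F 0 = t * (t * g ((x + r *\<^sub>R u) + s *\<^sub>R v))"
        using Fr by auto
      then have "(F t - F 0) / t\<^sup>2 = g ((x + r *\<^sub>R u) + s *\<^sub>R v)"
        using t by (simp add: power2_eq_square)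
      moreover have "F t - F 0 = f (x + t *\<^sub>R u + t *\<^sub>R v) - f (x + t *\<^sub>R u) - f (x + t *\<^sub>R v) + f x"
        by (simp add: F_def algebra_simps)
      ultimately show ?thesis
        using d0(2)[of "x + r *\<^sub>R u + s *\<^sub>R v"] near[of r t s] r s t by (simp add: d_def)
    qed
    show "\<forall>\<^sub>F t in at_right 0. dist ((f (x + t *\<^sub>R u + t *\<^sub>R v) - f (x + t *\<^sub>R u) - f (x + t *\<^sub>R v) + f x) / t\<^sup>2)
       (frechet_derivative (\<lambda>y. frechet_derivative f (at y) u) (at x) v) < e"
      using main \<open>\<delta> > 0\<close> unfolding eventually_at_right_field g_def by blast
  qed
qed

lemma second_derivative_symmetric:
  fixes f :: "'e::euclidean_space \<Rightarrow> real"
  assumes "open S" "x \<in> S" "smooth_on S f"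
  shows "frechet_derivative (\<lambda>y. frechet_derivative f (at y) u) (at x) v =
    frechet_derivative (\<lambda>y. frechet_derivative f (at y) v) (at x) u"
proof -
  have "(\<lambda>t. (f (x + t *\<^sub>R v + t *\<^sub>R u) - f (x + t *\<^sub>R v) - f (x + t *\<^sub>R u) + f x) / t\<^sup>2) =
      (\<lambda>t. (f (x + t *\<^sub>R u + t *\<^sub>R v) - f (x + t *\<^sub>R u) - f (x + t *\<^sub>R v) + f x) / t\<^sup>2)"
    by (simp add: algebra_simps)
  then show ?thesis
    using second_difference_tendsto[OF assms, of u v] second_difference_tendsto[OF assms, of v u]
    by (intro tendsto_unique[OF trivial_limit_at_right_real]) simp_all
qed

lemma second_derivative_symmetric_vector:
  fixes f :: "'e::euclidean_space \<Rightarrow> 'f::euclidean_space"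
  assumes "open S" "x \<in> S" "smooth_on S f"
  shows "frechet_derivative (\<lambda>y. frechet_derivative f (at y) u) (at x) v =
    frechet_derivative (\<lambda>y. frechet_derivative f (at y) v) (at x) u"
proof (rule euclidean_eqI)
  fix b :: 'f
  have inner: "frechet_derivative (\<lambda>y. h y \<bullet> b) (at y) w = frechet_derivative h (at y) w \<bullet> b"
    if "smooth_on S h" "y \<in> S" for h :: "'e \<Rightarrow> 'f" and y w
  proof -
    have "((\<lambda>y. h y \<bullet> b) has_derivative (\<lambda>w. frechet_derivative h (at y) w \<bullet> b)) (at y)"
      using smooth_on_differentiable[OF that]
      by (intro has_derivative_inner_left) (simp add: frechet_derivative_works)
    from fun_cong[OF frechet_derivative_at[OF this]] show ?thesis by simp
  qed
  have sm: "smooth_on S (\<lambda>y. f y \<bullet> b)"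
    using assms(3) times_cont_diff_on_bounded_linear[OF assms(1) _ bounded_linear_inner_left]
    unfolding smooth_on_def by blast
  have twice: "frechet_derivative (\<lambda>y. frechet_derivative f (at y) u) (at x) v \<bullet> b =
      frechet_derivative (\<lambda>y. frechet_derivative (\<lambda>y. f y \<bullet> b) (at y) u) (at x) v" for u v
  proof -
    note smd = smooth_on_frechet_derivative[OF assms(3), of u]
    have "frechet_derivative (\<lambda>y. frechet_derivative f (at y) u \<bullet> b) (at x) =
        frechet_derivative (\<lambda>y. frechet_derivative (\<lambda>y. f y \<bullet> b) (at y) u) (at x)"
    proof (rule frechet_derivative_transform_within_open[OF _ assms(1,2)])
      show "(\<lambda>y. frechet_derivative f (at y) u \<bullet> b) differentiable at x"
        using smooth_on_differentiable[OF smd assms(2)]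
        by (intro differentiable_inner) auto
    qed (simp add: inner[OF assms(3)])
    then show ?thesis using inner[OF smd assms(2), of v] by simp
  qed
  show "frechet_derivative (\<lambda>y. frechet_derivative f (at y) u) (at x) v \<bullet> b =
      frechet_derivative (\<lambda>y. frechet_derivative f (at y) v) (at x) u \<bullet> b"
    unfolding twice by (rule second_derivative_symmetric[OF assms(1,2) sm])
qed

section \<open>Charts\<close>

locale smooth_mfd =
  fixes A :: "('a::topological_space, 'e::euclidean_space) chart set"
  assumes atlas: "smooth_atlas A"
begin

lemma chart_at: "p \<in> mcarrier A \<Longrightarrow> chart_at A p \<in> A" "p \<in> mcarrier A \<Longrightarrow> p \<in> dom_of (chart_at A p)"
proof -
  assume "p \<in> mcarrier A"
  then have "\<exists>c. c \<in> A \<and> p \<in> dom_of c" by (auto simp: mcarrier_def)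
  then show "chart_at A p \<in> A" "p \<in> dom_of (chart_at A p)"
    unfolding chart_at_def by (metis (mono_tags, lifting) someI_ex)+
qed

lemma dom_subset_mcarrier: "c \<in> A \<Longrightarrow> p \<in> dom_of c \<Longrightarrow> p \<in> mcarrier A"
  by (auto simp: mcarrier_def)

lemma open_dom: "c \<in> A \<Longrightarrow> open (dom_of c)"
  using atlas by (auto simp: smooth_atlas_def is_chart_def)

lemma chart_inv_chart [simp]: "c \<in> A \<Longrightarrow> p \<in> dom_of c \<Longrightarrow> chart_inv c (map_of_chart c p) = p"
  using atlas by (auto simp: smooth_atlas_def is_chart_def homeomorphism_def)

lemma open_chart_image:
  assumes c: "c \<in> A" and "open U"
  shows "open (map_of_chart c ` (dom_of c \<inter> U))"
proof -
  have h: "homeomorphism (dom_of c) (map_of_chart c ` dom_of c) (map_of_chart c) (chart_inv c)"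
    "open (map_of_chart c ` dom_of c)"
    using atlas c by (auto simp: smooth_atlas_def is_chart_def)
  have "openin (top_of_set (map_of_chart c ` dom_of c)) (map_of_chart c ` (dom_of c \<inter> U))"
    using homeomorphism_imp_open_map[OF h(1)] \<open>open U\<close> by (simp add: openin_open_Int)
  then show ?thesis using h(2) openin_open_trans by blast
qed

lemma transition_smooth: "c \<in> A \<Longrightarrow> d \<in> A \<Longrightarrow>
    smooth_on (map_of_chart c ` (dom_of c \<inter> dom_of d)) (map_of_chart d \<circ> chart_inv c)"
  using atlas by (auto simp: smooth_atlas_def)

lemma transition_differentiable: "c \<in> A \<Longrightarrow> d \<in> A \<Longrightarrow> p \<in> dom_of c \<Longrightarrow> p \<in> dom_of d \<Longrightarrow>
    (map_of_chart d \<circ> chart_inv c) differentiable (at (map_of_chart c p))"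
  using smooth_on_differentiable[OF transition_smooth] by blast

text \<open>Near \<open>map_of_chart c p\<close> the map \<open>F \<circ> chart_inv c\<close> is
  \<open>F \<circ> chart_inv b\<close> after the transition map. The target of \<open>F\<close>
  stays general: real functions, coordinate maps and derivatives of transition maps are substituted
  for it below.\<close>

lemma chart_chain:
  assumes "b \<in> A" "c \<in> A" "p \<in> dom_of b" "p \<in> dom_of c"
    and F: "(F \<circ> chart_inv b) differentiable (at (map_of_chart b p))"
  shows "frechet_derivative (F \<circ> chart_inv c) (at (map_of_chart c p)) w =
    frechet_derivative (F \<circ> chart_inv b) (at (map_of_chart b p))
      (frechet_derivative (map_of_chart b \<circ> chart_inv c) (at (map_of_chart c p)) w)"
proof -
  have d: "(map_of_chart b \<circ> chart_inv c) differentiable (at (map_of_chart c p))"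
    using transition_differentiable assms by blast
  have F': "(F \<circ> chart_inv b) differentiable (at ((map_of_chart b \<circ> chart_inv c) (map_of_chart c p)))"
    using F assms by simp
  have "frechet_derivative ((F \<circ> chart_inv b) \<circ> (map_of_chart b \<circ> chart_inv c)) (at (map_of_chart c p)) =
      frechet_derivative (F \<circ> chart_inv c) (at (map_of_chart c p))"
  proof (rule frechet_derivative_transform_within_open)
    show "open (map_of_chart c ` (dom_of c \<inter> dom_of b))"
      using assms by (simp add: open_chart_image open_dom)
    show "(F \<circ> chart_inv b \<circ> (map_of_chart b \<circ> chart_inv c)) differentiable at (map_of_chart c p)"
      using differentiable_chain_at[OF d F'] .
  qed (use assms in auto)
  then have "frechet_derivative (F \<circ> chart_inv c) (at (map_of_chart c p)) =
      frechet_derivative (F \<circ> chart_inv b) (at ((map_of_chart b \<circ> chart_inv c) (map_of_chart c p))) \<circ>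
      frechet_derivative (map_of_chart b \<circ> chart_inv c) (at (map_of_chart c p))"
    by (simp only: frechet_derivative_compose[OF d F'])
  then show ?thesis
    by (simp only: o_apply chart_inv_chart[OF assms(2,4)])
qed

lemma frechet_derivative_chart_self:
  assumes "b \<in> A" "p \<in> dom_of b"
  shows "frechet_derivative (map_of_chart b \<circ> chart_inv b) (at (map_of_chart b p)) v = v"
proof -
  have "frechet_derivative (\<lambda>x. x) (at (map_of_chart b p)) =
      frechet_derivative (map_of_chart b \<circ> chart_inv b) (at (map_of_chart b p))"
    using assms open_chart_image[of b UNIV]
    by (intro frechet_derivative_transform_within_open[where X="map_of_chart b ` dom_of b"]) auto
  from fun_cong[OF this, of v] show ?thesis by (simp only: frechet_derivative_ident)
qed

lemma transition_inverse:
  assumes "b \<in> A" "c \<in> A" "p \<in> dom_of b" "p \<in> dom_of c"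
  shows "frechet_derivative (map_of_chart b \<circ> chart_inv c) (at (map_of_chart c p))
      (frechet_derivative (map_of_chart c \<circ> chart_inv b) (at (map_of_chart b p)) v) = v"
  using chart_chain[of c b p "map_of_chart b" v] transition_differentiable[of c b p]
    frechet_derivative_chart_self[of b p v] assms by simp

lemma components_chart:
  "c \<in> A \<Longrightarrow> p \<in> dom_of c \<Longrightarrow> components A c X (map_of_chart c p) =
    frechet_derivative (map_of_chart c \<circ> chart_inv (chart_at A p)) (at (map_of_chart (chart_at A p) p)) (X p)"
  by (simp add: components_def Let_def)

lemma linear_components:
  assumes "c \<in> A" "p \<in> dom_of c"
  shows "linear (frechet_derivative (map_of_chart c \<circ> chart_inv (chart_at A p))
    (at (map_of_chart (chart_at A p) p)))"
  using assms chart_at dom_subset_mcarrier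
  by (intro linear_frechet_derivative transition_differentiable) auto

section \<open>Smooth functions and vector fields\<close>

lemma smooth_vf_subset: "smooth_vf A W X \<Longrightarrow> W' \<subseteq> W \<Longrightarrow> smooth_vf A W' X"
  unfolding smooth_vf_def by (blast intro: smooth_on_subset)

lemma smooth_fun_const: "smooth_fun A W (\<lambda>q. r)"
  by (simp add: smooth_fun_def smooth_on_const comp_def)

lemma smooth_fun_cong:
  assumes "open_in_mfd A W" "smooth_fun A W f" "\<And>q. q \<in> W \<Longrightarrow> f q = f' q"
  shows "smooth_fun A W f'"
  unfolding smooth_fun_def
proof
  fix c assume c: "c \<in> A"
  show "smooth_on (map_of_chart c ` (dom_of c \<inter> W)) (f' \<circ> chart_inv c)"
    by (rule smooth_on_cong[where f="f \<circ> chart_inv c"])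
      (use assms c open_chart_image in \<open>auto simp: open_in_mfd_def smooth_fun_def\<close>)
qed

lemma smooth_vf_cong:
  assumes "open_in_mfd A W" "smooth_vf A W X" "\<And>q. q \<in> W \<Longrightarrow> X q = X' q"
  shows "smooth_vf A W X'"
  unfolding smooth_vf_def
proof
  fix c assume c: "c \<in> A"
  show "smooth_on (map_of_chart c ` (dom_of c \<inter> W)) (components A c X')"
    by (rule smooth_on_cong[where f="components A c X"])
      (use assms c open_chart_image in \<open>auto simp: open_in_mfd_def smooth_vf_def components_chart\<close>)
qed

lemma smooth_vf_add:
  assumes "open_in_mfd A W" "smooth_vf A W X" "smooth_vf A W Y"
  shows "smooth_vf A W (\<lambda>q. X q + Y q)"
  unfolding smooth_vf_def
proof
  fix c assume c: "c \<in> A"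
  show "smooth_on (map_of_chart c ` (dom_of c \<inter> W)) (components A c (\<lambda>q. X q + Y q))"
    by (rule smooth_on_cong[where f="\<lambda>y. components A c X y + components A c Y y"])
      (use assms c open_chart_image in \<open>auto intro!: smooth_on_add simp: open_in_mfd_def smooth_vf_def components_chart linear_add[OF linear_components]\<close>)
qed

lemma smooth_vf_scaleR:
  assumes "open_in_mfd A W" "smooth_fun A W f" "smooth_vf A W X"
  shows "smooth_vf A W (\<lambda>q. f q *\<^sub>R X q)"
  unfolding smooth_vf_def
proof
  fix c assume c: "c \<in> A"
  show "smooth_on (map_of_chart c ` (dom_of c \<inter> W)) (components A c (\<lambda>q. f q *\<^sub>R X q))"
  proof (rule smooth_on_cong)
    show S: "open (map_of_chart c ` (dom_of c \<inter> W))"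
      using assms c open_chart_image by (simp add: open_in_mfd_def)
    show "smooth_on (map_of_chart c ` (dom_of c \<inter> W))
        (\<lambda>y. (f \<circ> chart_inv c) y *\<^sub>R components A c X y)"
      using assms c unfolding smooth_fun_def smooth_vf_def by (intro smooth_on_scaleR[OF S]) blast+
  qed (use c in \<open>auto simp: components_chart linear_scale[OF linear_components]\<close>)
qed

lemma smooth_fun_differentiable:
  "smooth_fun A W f \<Longrightarrow> p \<in> W \<Longrightarrow> c \<in> A \<Longrightarrow> p \<in> dom_of c \<Longrightarrow>
    (f \<circ> chart_inv c) differentiable (at (map_of_chart c p))"
  unfolding smooth_fun_def by (blast intro: smooth_on_differentiable)

lemma dir_deriv_cong:
  assumes "open_in_mfd A W" "smooth_fun A W f" "\<And>q. q \<in> W \<Longrightarrow> f q = f' q" "p \<in> W"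
  shows "dir_deriv A X f p = dir_deriv A X f' p"
proof -
  have p: "p \<in> mcarrier A" using assms by (auto simp: open_in_mfd_def)
  let ?b = "chart_at A p"
  have "frechet_derivative (f \<circ> chart_inv ?b) (at (map_of_chart ?b p)) =
      frechet_derivative (f' \<circ> chart_inv ?b) (at (map_of_chart ?b p))"
    using assms chart_at[OF p] open_chart_image[of ?b W] smooth_fun_differentiable[of W f p ?b]
    by (intro frechet_derivative_transform_within_open[where X="map_of_chart ?b ` (dom_of ?b \<inter> W)"])
      (auto simp: open_in_mfd_def)
  then show ?thesis by (simp add: dir_deriv_def)
qed

lemma dir_deriv_const [simp]: "dir_deriv A X (\<lambda>q. r) p = 0"
  by (simp add: dir_deriv_def comp_def)

section \<open>Coordinate vector fields\<close>

text \<open>The field with constant components \<open>w\<close> in the chart \<open>c\<close>; the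
  differential of the transition map converts them to \<open>chart_at A p\<close>, the chart in
  which vectors at \<open>p\<close> are stored.\<close>

definition coord_vf :: "('a, 'e) chart \<Rightarrow> 'e \<Rightarrow> ('a, 'e) vfield" where
  "coord_vf c w p =
    frechet_derivative (map_of_chart (chart_at A p) \<circ> chart_inv c) (at (map_of_chart c p)) w"

lemma components_coord_vf:
  assumes "c \<in> A" "d \<in> A" "p \<in> dom_of c" "p \<in> dom_of d"
  shows "components A d (coord_vf c w) (map_of_chart d p) =
    frechet_derivative (map_of_chart d \<circ> chart_inv c) (at (map_of_chart c p)) w"
proof -
  have b: "chart_at A p \<in> A" "p \<in> dom_of (chart_at A p)"
    using chart_at[OF dom_subset_mcarrier] assms by auto
  show ?thesis
    unfolding components_chart[OF assms(2,4)] coord_vf_def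
    by (rule chart_chain[OF b(1) assms(1) b(2) assms(3) transition_differentiable[OF b(1) assms(2) b(2) assms(4)], symmetric])
qed

lemma smooth_coord_vf:
  assumes W: "open_in_mfd A W" and c: "c \<in> A" "W \<subseteq> dom_of c"
  shows "smooth_vf A W (coord_vf c w)"
  unfolding smooth_vf_def
proof
  fix d assume d: "d \<in> A"
  let ?S = "map_of_chart d ` (dom_of d \<inter> W)"
  have "smooth_on ?S (\<lambda>y. (\<lambda>z. frechet_derivative (map_of_chart d \<circ> chart_inv c) (at z) w)
      ((map_of_chart c \<circ> chart_inv d) y))"
  proof (rule smooth_on_compose[where h="map_of_chart c \<circ> chart_inv d" and
        f="\<lambda>z. frechet_derivative (map_of_chart d \<circ> chart_inv c) (at z) w"])
    show "open ?S" using W d by (simp add: open_chart_image open_in_mfd_def)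
    show "open (map_of_chart c ` (dom_of c \<inter> dom_of d))"
      using c d by (simp add: open_chart_image open_dom)
    show "smooth_on ?S (map_of_chart c \<circ> chart_inv d)"
      using transition_smooth[OF d c(1)] by (rule smooth_on_subset) (use c in auto)
    show "smooth_on (map_of_chart c ` (dom_of c \<inter> dom_of d))
        (\<lambda>z. frechet_derivative (map_of_chart d \<circ> chart_inv c) (at z) w)"
      using c d by (intro smooth_on_frechet_derivative transition_smooth)
    show "(map_of_chart c \<circ> chart_inv d) ` ?S \<subseteq> map_of_chart c ` (dom_of c \<inter> dom_of d)"
      using c d by auto
  qed
  then show "smooth_on ?S (components A d (coord_vf c w))"
  proof (rule smooth_on_cong[rotated 2])
    show "open ?S" using W d by (simp add: open_chart_image open_in_mfd_def)
    fix y assume "y \<in> ?S"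
    then obtain p where "p \<in> dom_of d" "p \<in> W" "y = map_of_chart d p" by auto
    then show "frechet_derivative (map_of_chart d \<circ> chart_inv c) (at ((map_of_chart c \<circ> chart_inv d) y)) w =
        components A d (coord_vf c w) y"
      using c d by (auto simp: components_coord_vf subset_iff)
  qed
qed

lemma dir_deriv_coord_vf:
  assumes "open_in_mfd A W" "smooth_fun A W f" "p \<in> W" "c \<in> A" "p \<in> dom_of c"
  shows "dir_deriv A (coord_vf c w) f p = frechet_derivative (f \<circ> chart_inv c) (at (map_of_chart c p)) w"
proof -
  have b: "chart_at A p \<in> A" "p \<in> dom_of (chart_at A p)"
    using chart_at[OF dom_subset_mcarrier] assms by auto
  show ?thesis
    unfolding dir_deriv_def coord_vf_def
    by (rule chart_chain[OF b(1) assms(4) b(2) assms(5) smooth_fun_differentiable[OF assms(2,3) b], symmetric])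
qed

lemma coord_vf_surj:
  assumes "c \<in> A" "p \<in> dom_of c"
  obtains w where "coord_vf c w p = v"
proof -
  have b: "chart_at A p \<in> A" "p \<in> dom_of (chart_at A p)"
    using chart_at[OF dom_subset_mcarrier] assms by auto
  show ?thesis
    using that transition_inverse[OF b(1) assms(1) b(2) assms(2)] unfolding coord_vf_def by blast
qed

text \<open>The components of \<open>coord_vf c w\<close> in \<open>chart_at A p\<close> are the
  derivative of the transition map in the direction \<open>w\<close>. Differentiating them along
  \<open>coord_vf c u\<close> gives a second derivative of the transition map, which is symmetric in
  the two directions.\<close>

lemma lie_bracket_coord_vf:
  assumes c: "c \<in> A" and p: "p \<in> dom_of c"
  shows "lie_bracket A (coord_vf c u) (coord_vf c v) p = 0"
proof -
  let ?b = "chart_at A p"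
  define S where "S = map_of_chart c ` (dom_of c \<inter> dom_of ?b)"
  have b: "?b \<in> A" "p \<in> dom_of ?b" using chart_at[OF dom_subset_mcarrier[OF c p]] by auto
  have S: "open S" "map_of_chart c p \<in> S"
    using b c p by (auto simp: S_def open_chart_image open_dom)
  have sm: "smooth_on S (map_of_chart ?b \<circ> chart_inv c)"
    unfolding S_def using b c by (intro transition_smooth)
  have "frechet_derivative (components A ?b (coord_vf c w)) (at (map_of_chart ?b p)) (coord_vf c u p) =
      frechet_derivative (\<lambda>z. frechet_derivative (map_of_chart ?b \<circ> chart_inv c) (at z) w)
        (at (map_of_chart c p)) u" for u w
  proof -
    define k where "k = (\<lambda>z. frechet_derivative (map_of_chart ?b \<circ> chart_inv c) (at z) w)"
    \<comment> \<open>Regarding the components as a function on the manifold allows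
      \<open>chart_chain\<close> to pass from \<open>?b\<close> to \<open>c\<close>, where
      \<open>coord_vf c u\<close> has the constant components \<open>u\<close>.\<close>
    define F where "F = (\<lambda>q. k (map_of_chart c q))"
    have smk: "smooth_on S k"
      unfolding k_def by (rule smooth_on_frechet_derivative[OF sm])
    have Fc: "(F \<circ> chart_inv c) y = k y" if "y \<in> S" for y
      using that c by (auto simp: F_def S_def)
    have smF: "smooth_on S (F \<circ> chart_inv c)"
      using S(1) Fc[symmetric] smk by (rule smooth_on_cong)
    have kF: "frechet_derivative k (at (map_of_chart c p)) = frechet_derivative (F \<circ> chart_inv c) (at (map_of_chart c p))"
      using smooth_on_differentiable[OF smk] S Fc
      by (intro frechet_derivative_transform_within_open[where X=S]) auto
    have diffc: "(F \<circ> chart_inv c) differentiable (at (map_of_chart c p))"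
      using smooth_on_differentiable[OF smF S(2)] .
    have diffb: "(F \<circ> chart_inv ?b) differentiable (at (map_of_chart ?b p))"
    proof -
      let ?T = "map_of_chart ?b ` (dom_of ?b \<inter> dom_of c)"
      have T: "open ?T" using b c by (simp add: open_chart_image open_dom)
      have "smooth_on ?T (\<lambda>y. k ((map_of_chart c \<circ> chart_inv ?b) y))"
        using b c by (intro smooth_on_compose[OF T S(1) transition_smooth smk]) (auto simp: S_def)
      then show ?thesis
        using b p by (intro smooth_on_differentiable[where S="?T"]) (auto simp: F_def comp_def)
    qed
    have comp: "frechet_derivative (components A ?b (coord_vf c w)) (at (map_of_chart ?b p)) =
        frechet_derivative (F \<circ> chart_inv ?b) (at (map_of_chart ?b p))"
    proof (rule frechet_derivative_transform_within_open[OF diffb, symmetric])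
      show "open (map_of_chart ?b ` (dom_of ?b \<inter> dom_of c))"
        using b c by (simp add: open_chart_image open_dom)
      show "map_of_chart ?b p \<in> map_of_chart ?b ` (dom_of ?b \<inter> dom_of c)" using b p by auto
      fix y assume "y \<in> map_of_chart ?b ` (dom_of ?b \<inter> dom_of c)"
      then show "(F \<circ> chart_inv ?b) y = components A ?b (coord_vf c w) y"
        using b c by (auto simp: F_def k_def components_coord_vf)
    qed
    have "frechet_derivative (F \<circ> chart_inv ?b) (at (map_of_chart ?b p)) (coord_vf c u p) = frechet_derivative (F \<circ> chart_inv c) (at (map_of_chart c p)) u"
      unfolding coord_vf_def by (rule chart_chain[symmetric]) (use b c p diffb in auto)
    then show ?thesis unfolding comp kF[symmetric] k_def .
  qed
  then show ?thesis
    using second_derivative_symmetric_vector[OF S sm, of v u]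
    by (simp add: lie_bracket_def Let_def)
qed

end

section \<open>Linear algebra of the first derivatives at a point\<close>

locale acm_space =
  fixes G :: "'e::euclidean_space \<Rightarrow> 'e \<Rightarrow> real" and \<phi> :: "'e \<Rightarrow> 'e" and \<xi> :: 'e
  assumes G_bilinear: "bilinear G"
    and G_sym: "G u v = G v u"
    and G_pos: "v \<noteq> 0 \<Longrightarrow> G v v > 0"
    and phi_linear: "linear \<phi>"
    and xi_unit: "G \<xi> \<xi> = 1"
    and phi_phi: "\<phi> (\<phi> v) = - v + G \<xi> v *\<^sub>R \<xi>"
    and phi_compat: "G (\<phi> u) (\<phi> v) = G u v - G \<xi> u * G \<xi> v"
begin

lemmas G_simps [simp] =
  bilinear_ladd[OF G_bilinear] bilinear_radd[OF G_bilinear]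
  bilinear_lsub[OF G_bilinear] bilinear_rsub[OF G_bilinear]
  bilinear_lmul[OF G_bilinear] bilinear_rmul[OF G_bilinear]
  bilinear_lneg[OF G_bilinear] bilinear_rneg[OF G_bilinear]
  bilinear_lzero[OF G_bilinear] bilinear_rzero[OF G_bilinear]
  bilinear_sum[OF G_bilinear]

lemmas phi_simps [simp] =
  linear_add[OF phi_linear] linear_diff[OF phi_linear] linear_scale[OF phi_linear]
  linear_neg[OF phi_linear] linear_0[OF phi_linear]

lemma G_eq_0_iff [simp]: "G v v = 0 \<longleftrightarrow> v = 0"
  by (cases "v = 0") (use G_pos[of v] in simp_all)

lemma G_eqI: "(\<And>w. G u w = G v w) \<Longrightarrow> u = v"
proof -
  assume "\<And>w. G u w = G v w"
  then have "G (u - v) (u - v) = 0" by (simp add: bilinear_lsub[OF G_bilinear])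
  then show "u = v" unfolding G_eq_0_iff by simp
qed

lemma phi_xi [simp]: "\<phi> \<xi> = 0"
  using phi_compat[of \<xi> \<xi>] by (simp add: xi_unit)

lemma xi_nonzero [simp]: "\<xi> \<noteq> 0"
  using xi_unit by auto

lemma G_xi_phi [simp]: "G \<xi> (\<phi> v) = 0"
proof -
  \<comment> \<open>Using \<open>phi_phi\<close> on the inner or on the outer pair gives two values
    of the triple product; they differ by a multiple of \<xi> with coefficient
    \<open>G \<xi> (\<phi> v)\<close>.\<close>
  have "\<phi> (\<phi> (\<phi> v)) = - \<phi> v" by (simp add: phi_phi[of v])
  then show ?thesis by (simp add: phi_phi[of "\<phi> v"])
qed

lemma G_phi_xi [simp]: "G (\<phi> v) \<xi> = 0"
  using G_xi_phi[of v] by (simp add: G_sym)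

lemma phi_skew: "G (\<phi> u) v = - G u (\<phi> v)"
  using phi_compat[of u "\<phi> v"] by (simp add: phi_phi)

text \<open>Pairing a linear combination with \<open>e j\<close> reads off its coefficient. Hence
  the \<open>e i\<close> are distinct and independent, they span because there are
  \<open>DIM('e)\<close> of them, and the coefficients of \<open>v\<close> are its pairings.\<close>

lemma G_orthonormal_expansion:
  assumes "\<And>i j. i < DIM('e) \<Longrightarrow> j < DIM('e) \<Longrightarrow> G (e i) (e j) = (if i = j then 1 else 0)"
  shows "v = (\<Sum>i<DIM('e). G v (e i) *\<^sub>R e i)"
proof -
  let ?I = "{..<DIM('e)}"
  have GS: "G (\<Sum>i\<in>?I. c i *\<^sub>R e i) (e j) = c j" if "j < DIM('e)" for c j
  proof -
    have "G (\<Sum>i\<in>?I. c i *\<^sub>R e i) (e j) = (\<Sum>i\<in>?I. G (c i *\<^sub>R e i) (e j))"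
      using G_bilinear unfolding bilinear_def by (simp add: linear_sum[of "\<lambda>u. G u (e j)"])
    also have "\<dots> = (\<Sum>i\<in>?I. if i = j then c i else 0)"
      using that by (intro sum.cong) (auto simp: assms)
    finally show ?thesis using that by simp
  qed
  have inj: "inj_on e ?I"
  proof (rule inj_onI)
    fix i j assume "i \<in> ?I" "j \<in> ?I" "e i = e j"
    then show "i = j" using assms[of i j] assms[of j j] by (auto split: if_splits)
  qed
  have "independent (e ` ?I)"
  proof (rule independent_if_scalars_zero)
    fix f x assume z: "(\<Sum>x\<in>e ` ?I. f x *\<^sub>R x) = 0" and "x \<in> e ` ?I"
    then obtain j where j: "j < DIM('e)" "x = e j" by auto
    have "(\<Sum>i\<in>?I. f (e i) *\<^sub>R e i) = 0"
      using z by (simp add: sum.reindex[OF inj])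
    then show "f x = 0" using GS[OF j(1), of "\<lambda>i. f (e i)"] j by simp
  qed simp
  then have "UNIV \<subseteq> span (e ` ?I)"
    by (intro card_ge_dim_independent) (simp_all add: card_image[OF inj])
  then have "v \<in> span (e ` ?I)" by auto
  then obtain f where "v = (\<Sum>x\<in>e ` ?I. f x *\<^sub>R x)"
    by (auto simp: span_finite)
  then have v: "v = (\<Sum>i\<in>?I. f (e i) *\<^sub>R e i)"
    by (simp add: sum.reindex[OF inj])
  show ?thesis
    by (subst v, intro sum.cong refl, subst v, subst GS) auto
qed

end

text \<open>In the following locales \<open>s\<close>, \<open>N\<close> and \<open>M\<close> stand for the values of \<open>\<nabla>\<xi>\<close>, \<open>\<nabla>\<phi>\<close> and \<open>\<nabla>\<sigma>\<close> at
  a point, and \<open>N_cyclic\<close> for \<open>d\<Phi> = 0\<close>.\<close>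

locale contact_jet = acm_space G \<phi> \<xi> for G :: "'e::euclidean_space \<Rightarrow> 'e \<Rightarrow> real" and \<phi> \<xi> +
  fixes s \<sigma> :: "'e \<Rightarrow> 'e" and N :: "'e \<Rightarrow> 'e \<Rightarrow> 'e"
  assumes s_linear: "linear s"
    and sigma_def: "\<sigma> v = s v + \<phi> v"
    and s_skew: "G (s u) v - G (s v) u = 2 * G u (\<phi> v)"
    and G_xi_s [simp]: "G \<xi> (s u) = 0"
    and N_bilinear: "bilinear N"
    and N_skew: "G (N u v) w = - G v (N u w)"
    and N_phi: "N u (\<phi> v) + \<phi> (N u v) = G (s u) v *\<^sub>R \<xi> + G \<xi> v *\<^sub>R s u"
    and N_cyclic: "G (N u v) w + G (N v w) u + G (N w u) v = 0"
begin

lemma sigma_linear: "linear \<sigma>"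
  using linear_compose_add[OF s_linear phi_linear] by (simp flip: sigma_def)

lemmas s_simps [simp] =
  linear_add[OF s_linear] linear_diff[OF s_linear] linear_scale[OF s_linear]
  linear_neg[OF s_linear] linear_0[OF s_linear]
  linear_add[OF sigma_linear] linear_diff[OF sigma_linear] linear_scale[OF sigma_linear]
  linear_neg[OF sigma_linear] linear_0[OF sigma_linear]

lemmas N_simps [simp] =
  bilinear_ladd[OF N_bilinear] bilinear_radd[OF N_bilinear]
  bilinear_lsub[OF N_bilinear] bilinear_rsub[OF N_bilinear]
  bilinear_lmul[OF N_bilinear] bilinear_rmul[OF N_bilinear]
  bilinear_lneg[OF N_bilinear] bilinear_rneg[OF N_bilinear]
  bilinear_lzero[OF N_bilinear] bilinear_rzero[OF N_bilinear]

lemma G_s_xi [simp]: "G (s u) \<xi> = 0"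
  using G_xi_s[of u] by (simp add: G_sym)

lemma s_sigma: "s v = \<sigma> v - \<phi> v"
  by (simp add: sigma_def)

lemma sigma_sym: "G (\<sigma> u) v = G u (\<sigma> v)"
  using s_skew[of u v] phi_skew[of u v] G_sym[of "s v" u] by (simp add: sigma_def)

text \<open>The integral curves of \<xi> are geodesics: in \<open>s_skew\<close> with u = \<xi> the
  other terms pair \<xi> with values of \<open>s\<close> and \<phi>, which are orthogonal to
  it.\<close>

lemma s_xi [simp]: "s \<xi> = 0"
proof (rule G_eqI)
  show "G (s \<xi>) w = G 0 w" for w
    using s_skew[of \<xi> w] by simp
qed

lemma sigma_xi [simp]: "\<sigma> \<xi> = 0" by (simp add: sigma_def)

lemma G_xi_sigma [simp]: "G \<xi> (\<sigma> v) = 0" "G (\<sigma> v) \<xi> = 0"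
  by (simp_all add: sigma_def)

lemma N_xi_right: "N u \<xi> = - \<phi> (s u)"
proof -
  have "G \<xi> (N u \<xi>) = 0" using N_skew[of u \<xi> \<xi>] by (simp add: G_sym)
  moreover have "\<phi> (N u \<xi>) = s u" using N_phi[of u \<xi>] by (simp add: xi_unit)
  ultimately show ?thesis using phi_phi[of "N u \<xi>"] by simp
qed

text \<open>In the cyclic identity with \<xi> as first entry, the two other terms reduce by
  \<open>N_skew\<close> to values of \<open>N\<close> at \<xi> in the second slot, which
  \<open>N_xi_right\<close> gives.\<close>

lemma N_xi_left_eq: "N \<xi> v = - (\<phi> (\<sigma> v) + \<sigma> (\<phi> v))"
proof (rule G_eqI)
  fix w
  have "G (N \<xi> v) w = - G (N v w) \<xi> - G (N w \<xi>) v"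
    using N_cyclic[of \<xi> v w] by simp
  also have "\<dots> = - G w (\<phi> (s v)) + G (\<phi> (s w)) v"
    by (subst N_skew) (simp add: N_xi_right)
  also have "\<dots> = - G w (\<phi> (s v)) - G (s w) (\<phi> v)"
    by (simp add: phi_skew)
  also have "G (s w) (\<phi> v) = G w (\<sigma> (\<phi> v)) + G w (\<phi> (\<phi> v))"
    using sigma_sym[of w "\<phi> v"] phi_skew[of w "\<phi> v"] by (simp add: s_sigma)
  finally show "G (N \<xi> v) w = G (- (\<phi> (\<sigma> v) + \<sigma> (\<phi> v))) w"
    by (simp add: s_sigma G_sym[of _ w])
qed

text \<open>By \<open>N_phi\<close> the operator \<open>N \<xi>\<close> anticommutes with \<phi>,
  while the formula in \<open>N_xi_left_eq\<close> makes it commute with \<phi>. Both can hold only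
  if \<phi>\<sigma>\<phi> = \<sigma>.\<close>

lemma sigma_phi: "\<sigma> (\<phi> v) = - \<phi> (\<sigma> v)"
proof -
  have "\<phi> (N \<xi> v) + N \<xi> (\<phi> v) = 0" using N_phi[of \<xi> v] by (simp add: add.commute)
  then have "\<phi> (\<sigma> (\<phi> v)) = \<sigma> v"
    by (simp add: N_xi_left_eq phi_phi algebra_simps) (metis add_left_cancel scaleR_2 scaleR_cancel_left zero_neq_numeral add.commute)
  from arg_cong[OF this, of \<phi>] have "- \<sigma> (\<phi> v) = \<phi> (\<sigma> v)" by (simp add: phi_phi)
  then show ?thesis by (metis minus_minus)
qed

lemma N_xi_left [simp]: "N \<xi> v = 0"
  by (simp add: N_xi_left_eq sigma_phi)

end

text \<open>\<open>M_sym\<close>, \<open>M_xi_right\<close> and \<open>M_phi\<close> are the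
  derivatives of the symmetry of \<sigma>, of \<sigma>\<xi> = 0 and of \<sigma>\<phi> +
  \<phi>\<sigma> = 0. As the second covariant derivative of \<xi> is \<open>M - N\<close>, the left
  side of \<open>nullity\<close> is R(u, v)\<xi>; the bracket after \<mu>/2 is the Lie derivative of
  \<phi>, that is, 2h.\<close>

locale contact_nullity_jet = contact_jet G \<phi> \<xi> s \<sigma> N
  for G :: "'e::euclidean_space \<Rightarrow> 'e \<Rightarrow> real" and \<phi> \<xi> s \<sigma> N +
  fixes M :: "'e \<Rightarrow> 'e \<Rightarrow> 'e" and \<kappa> \<mu> :: real
  assumes M_bilinear: "bilinear M"
    and M_sym: "G (M u v) w = G v (M u w)"
    and M_xi_right: "M u \<xi> = - \<sigma> (s u)"
    and M_phi: "N u (\<sigma> v) + \<phi> (M u v) + M u (\<phi> v) + \<sigma> (N u v) = 0"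
    and nullity: "(M u v - N u v) - (M v u - N v u) =
      (\<lambda>w. \<kappa> *\<^sub>R w + (\<mu> / 2) *\<^sub>R (N \<xi> w - s (\<phi> w) + \<phi> (s w))) (G \<xi> v *\<^sub>R u - G \<xi> u *\<^sub>R v)"
begin

lemmas M_simps [simp] =
  bilinear_ladd[OF M_bilinear] bilinear_radd[OF M_bilinear]
  bilinear_lsub[OF M_bilinear] bilinear_rsub[OF M_bilinear]
  bilinear_lmul[OF M_bilinear] bilinear_rmul[OF M_bilinear]
  bilinear_lneg[OF M_bilinear] bilinear_rneg[OF M_bilinear]
  bilinear_lzero[OF M_bilinear] bilinear_rzero[OF M_bilinear]

text \<open>For w in the kernel of \<open>G \<xi>\<close>, the value of R(w, \<xi>)\<xi> gives an
  equation \<open>R\<close> in which \<phi>\<sigma> and \<open>M \<xi>\<close> anticommute with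
  \<phi>, while the other operators commute with it. Adding the equation at \<open>\<phi> u\<close>
  to the image under \<phi> of that at \<open>u\<close> therefore eliminates both.\<close>

lemma sigma_sigma: "\<sigma> (\<sigma> v) = (1 - \<kappa>) *\<^sub>R (v - G \<xi> v *\<^sub>R \<xi>)"
proof -
  have D: "\<sigma> (\<sigma> u) = (1 - \<kappa>) *\<^sub>R u" if u: "G \<xi> u = 0" for u
  proof -
    have R: "\<kappa> *\<^sub>R w + \<mu> *\<^sub>R \<phi> (\<sigma> w) = w - \<sigma> (\<sigma> w) - M \<xi> w" if w: "G \<xi> w = 0" for w
    proof -
      have "(\<mu> / 2) *\<^sub>R (N \<xi> w - s (\<phi> w) + \<phi> (s w)) = \<mu> *\<^sub>R \<phi> (\<sigma> w)"
        by (simp add: s_sigma sigma_phi) (metis scaleR_2 scaleR_scaleR times_divide_eq_left nonzero_mult_div_cancel_right zero_neq_numeral)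
      then have "\<kappa> *\<^sub>R w + \<mu> *\<^sub>R \<phi> (\<sigma> w) = M w \<xi> - N w \<xi> - M \<xi> w"
        using nullity[of w \<xi>] w by (simp add: xi_unit)
      also have "M w \<xi> - N w \<xi> = w - \<sigma> (\<sigma> w)"
        using w by (simp add: M_xi_right N_xi_right s_sigma sigma_phi phi_phi algebra_simps)
      finally show ?thesis by simp
    qed
    have "M \<xi> (\<phi> u) = - \<phi> (M \<xi> u)"
      using M_phi[of \<xi> u] by (simp add: eq_neg_iff_add_eq_0 add.commute)
    then have 1: "\<kappa> *\<^sub>R \<phi> u + \<mu> *\<^sub>R \<phi> (\<sigma> (\<phi> u)) = \<phi> u - \<phi> (\<sigma> (\<sigma> u)) + \<phi> (M \<xi> u)"
      using R[of "\<phi> u"] by (simp add: sigma_phi)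
    have 2: "\<kappa> *\<^sub>R \<phi> u - \<mu> *\<^sub>R \<phi> (\<sigma> (\<phi> u)) = \<phi> u - \<phi> (\<sigma> (\<sigma> u)) - \<phi> (M \<xi> u)"
      using arg_cong[OF R[OF u], of \<phi>] by (simp add: sigma_phi)
    have "\<phi> (\<sigma> (\<sigma> u)) + \<phi> (\<sigma> (\<sigma> u)) = (1 - \<kappa>) *\<^sub>R \<phi> u + (1 - \<kappa>) *\<^sub>R \<phi> u"
      using arg_cong2[OF 1 2, of "(+)"] by (simp add: algebra_simps)
    then have "\<phi> (\<sigma> (\<sigma> u)) = (1 - \<kappa>) *\<^sub>R \<phi> u" by (metis scaleR_2 scaleR_cancel_left zero_neq_numeral)
    from arg_cong[OF this, of \<phi>] show ?thesis by (simp add: phi_phi u)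
  qed
  show ?thesis using D[of "v - G \<xi> v *\<^sub>R \<xi>"] by (simp add: xi_unit)
qed

section \<open>The derivatives of \<phi> and \<sigma> on the contact distribution\<close>

abbreviation D :: "'e \<Rightarrow> bool" where "D v \<equiv> G \<xi> v = 0"

abbreviation a :: "'e \<Rightarrow> 'e \<Rightarrow> 'e \<Rightarrow> real" where "a u v w \<equiv> G (N u v) w"
abbreviation b :: "'e \<Rightarrow> 'e \<Rightarrow> 'e \<Rightarrow> real" where "b u v w \<equiv> G (M u v) w"

lemma a_phi_middle: "D v \<Longrightarrow> D w \<Longrightarrow> a u (\<phi> v) w = a u v (\<phi> w)"
  using arg_cong[OF N_phi[of u v], of "\<lambda>x. G x w"] by (simp add: phi_skew)

text \<open>This is the quasi-Kaehler identity of almost Kaehler geometry. By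
  \<open>a_phi_middle\<close> the cyclic identities with \<phi> in one slot involve three values
  with \<phi> in the first slot and three with \<phi> further right; the identity with \<phi> in
  every slot makes the former sum to zero, and the system is solved.\<close>

lemma a_phi_left:
  assumes "D u" "D v" "D w"
  shows "a (\<phi> u) v w = a u v (\<phi> w)"
proof -
  have N2: "a x (\<phi> y) (\<phi> z) = - a x y z" if "D y" "D z" for x y z
    using a_phi_middle[of y "\<phi> z" x] that by (simp add: phi_phi)
  show ?thesis
    using N_cyclic[of "\<phi> u" v w] N_cyclic[of u "\<phi> v" w] N_cyclic[of u v "\<phi> w"]
      N_cyclic[of "\<phi> u" "\<phi> v" "\<phi> w"] assms
    by (simp add: a_phi_middle N2 phi_phi)
qed

lemma a_phi_phi:
  assumes "D u" "D v" "D w"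
  shows "a (\<phi> u) (\<phi> v) w = - a u v w" "a (\<phi> u) v (\<phi> w) = - a u v w"
    "a u (\<phi> v) (\<phi> w) = - a u v w"
  using assms by (simp_all add: a_phi_left a_phi_middle phi_phi)

text \<open>Obtained by pairing \<open>M_phi\<close> with \<open>\<phi> w\<close>: the failure of
  \<open>b\<close> to change sign under \<phi> in its last two arguments is governed by
  \<open>a\<close> alone.\<close>

lemma b_phi_phi:
  assumes "D u" "D v" "D w"
  shows "b u (\<phi> v) (\<phi> w) + b u v w = a u v (\<phi> (\<sigma> w)) - a u (\<phi> (\<sigma> v)) w"
proof -
  have "a u (\<sigma> v) (\<phi> w) + b u v w + b u (\<phi> v) (\<phi> w) - a u v (\<phi> (\<sigma> w)) = 0"
    using arg_cong[OF M_phi[of u v], of "\<lambda>x. G x (\<phi> w)"] assms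
    by (simp add: phi_skew phi_phi sigma_sym sigma_phi)
  moreover have "a u (\<phi> (\<sigma> v)) w = a u (\<sigma> v) (\<phi> w)"
    using assms by (intro a_phi_middle) simp_all
  ultimately show ?thesis by simp
qed

lemma nullity_D: "D u \<Longrightarrow> D v \<Longrightarrow> b u v w - b v u w = a u v w - a v u w"
  using arg_cong[OF nullity[of u v], of "\<lambda>x. G x w"] by simp

text \<open>On D the nullity condition makes the antisymmetrization of \<open>b\<close> equal to
  that of \<open>a\<close>, which the cyclic identity turns into a single term.\<close>

lemma b_minus_b: "D u \<Longrightarrow> D v \<Longrightarrow> b u v w - b v u w = - a w u v"
  using nullity_D[of u v w] N_cyclic[of u v w] N_skew[of v w u] by (simp add: G_sym)

text \<open>The four instances of \<open>b_minus_b\<close> in which \<open>\<phi>\<close> is applied to none or two of the vectors have, up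
  to sign, the same right-hand side; eliminating \<open>b\<close> leaves an identity in \<open>a\<close> and \<open>\<phi>\<sigma>\<close> alone.\<close>

lemma a_h:
  assumes x: "D x" and y: "D y" and z: "D z"
  shows "a (\<phi> (\<sigma> z)) x y = 0"
proof -
  define q where "q u v w = a u v (\<phi> (\<sigma> w)) - a u (\<phi> (\<sigma> v)) w" for u v w
  have b2: "b u (\<phi> v) (\<phi> w) + b u v w = q u v w" if "D u" "D v" "D w" for u v w
    using b_phi_phi[OF that] by (simp add: q_def)
  have q: "q (\<phi> u) v (\<phi> w) = a u (\<phi> (\<sigma> v)) w + a u v (\<phi> (\<sigma> w))"
    if "D u" "D v" "D w" for u v w
    using that by (simp add: q_def sigma_phi a_phi_phi phi_phi a_phi_left a_phi_middle)
  have E0: "b x y z - b y x z = - a z x y"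
    using b_minus_b[of x y z] x y by simp
  have E13: "b (\<phi> x) y (\<phi> z) - b y (\<phi> x) (\<phi> z) = a z x y"
    using b_minus_b[of "\<phi> x" y "\<phi> z"] x y z by (simp add: a_phi_phi)
  have E23: "b x (\<phi> y) (\<phi> z) - b (\<phi> y) x (\<phi> z) = a z x y"
    using b_minus_b[of x "\<phi> y" "\<phi> z"] x y z by (simp add: a_phi_phi)
  have E12: "b (\<phi> x) (\<phi> y) z - b (\<phi> y) (\<phi> x) z = a z x y"
    using b_minus_b[of "\<phi> x" "\<phi> y" z] x y z by (simp add: a_phi_phi)
  have "b (\<phi> x) y (\<phi> z) - b (\<phi> x) (\<phi> y) z = q (\<phi> x) y (\<phi> z)"
    "b (\<phi> y) x (\<phi> z) - b (\<phi> y) (\<phi> x) z = q (\<phi> y) x (\<phi> z)"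
    using b2[of "\<phi> x" y "\<phi> z"] b2[of "\<phi> y" x "\<phi> z"] x y z by (simp_all add: phi_phi)
  \<comment> \<open>In \<open>E13 + E23 - E12 + E0\<close> the right-hand sides cancel, and
    \<open>b2\<close> removes all \<open>b\<close>. What remains is
    \<open>q x y z + q (\<phi> x) y (\<phi> z)\<close>, which equals
    \<open>2 * a x y (\<phi> (\<sigma> z))\<close>, minus the same with \<open>x\<close> and
    \<open>y\<close> exchanged.\<close>
  then have "a x y (\<phi> (\<sigma> z)) = a y x (\<phi> (\<sigma> z))"
    using E0 E13 E23 E12 b2[OF x y z] b2[OF y x z] q[OF x y z] q[OF y x z]
      q_def[of x y z] q_def[of y x z] by linarith
  \<comment> \<open>By this symmetry and \<open>N_skew\<close>, the first two terms of the cyclic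
    sum over \<open>x\<close>, \<open>y\<close>, \<open>\<phi> (\<sigma> z)\<close> cancel.\<close>
  then show ?thesis
    using N_cyclic[of x y "\<phi> (\<sigma> z)"] N_skew[of y "\<phi> (\<sigma> z)" x] by (simp add: G_sym)
qed

text \<open>By symmetry of \<sigma>, the squared length of \<sigma>x is the pairing of x with
  \<sigma>\<sigma>x, which vanishes for \<kappa> = 1.\<close>

lemma sigma_zero: "\<kappa> = 1 \<Longrightarrow> \<sigma> x = 0"
  using sigma_sym[of x "\<sigma> x"] by (simp add: sigma_sigma)

end

text \<open>That \<sigma> vanishes at one point says nothing about its derivative there. For
  \<kappa> = 1, \<open>sigma_zero\<close> holds at all points of an open set, so \<open>M\<close>
  vanishes as well; this is not visible at a single point and enters as an assumption.\<close>

locale contact_nullity_jet_flat = contact_nullity_jet G \<phi> \<xi> s \<sigma> N M \<kappa> \<mu>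
  for G :: "'e::euclidean_space \<Rightarrow> 'e \<Rightarrow> real" and \<phi> \<xi> s \<sigma> N M \<kappa> \<mu> +
  assumes M_zero: "\<kappa> = 1 \<Longrightarrow> M u v = 0"
begin

lemma a_zero:
  assumes "D v" "D w"
  shows "a u v w = 0"
proof -
  have D0: "a z v w = 0" if z: "D z" for z
  proof (cases "\<kappa> = 1")
    case True
    then show ?thesis using M_zero b_minus_b[of v w z] assms by simp
  next
    case False
    \<comment> \<open>This is h applied twice, so z is up to a nonzero factor in the image of h,
      where \<open>a_h\<close> applies.\<close>
    have "\<phi> (\<sigma> (\<phi> (\<sigma> z))) = (1 - \<kappa>) *\<^sub>R z"
      using z by (simp add: sigma_phi phi_phi sigma_sigma)
    then show ?thesis
      using a_h[of v w "\<phi> (\<sigma> z)"] assms False by simp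
  qed
  have "a u v w = a (u - G \<xi> u *\<^sub>R \<xi>) v w" by simp
  also have "\<dots> = 0" by (rule D0) (simp add: xi_unit)
  finally show ?thesis .
qed

lemma N_D: "D v \<Longrightarrow> N u v = G \<xi> (N u v) *\<^sub>R \<xi>"
proof (rule G_eqI)
  fix w assume v: "D v"
  show "a u v w = G (G \<xi> (N u v) *\<^sub>R \<xi>) w"
    using a_zero[OF v, of "w - G \<xi> w *\<^sub>R \<xi>" u] by (simp add: xi_unit G_sym)
qed

text \<open>The derivative of the orthogonality of \<open>s v\<close> and \<xi>. It supplies the
  term with the squared norm of \<nabla>\<xi> in \<tau>(\<xi>).\<close>

lemma G_nabla_s_xi: "G (M u v - N u v) \<xi> = - G (s v) (s u)"
  using M_sym[of u v \<xi>] N_skew[of u v \<xi>]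
  by (simp add: M_xi_right N_xi_right sigma_sym phi_skew s_sigma sigma_phi)

text \<open>Since \<open>a\<close> vanishes on D, \<open>b_minus_b\<close> and \<open>M_sym\<close>
  make \<open>b\<close> totally symmetric there, so the sign change under \<phi> in the last two
  arguments carries over to the first two.\<close>

lemma b_phi_phi_left:
  assumes "D u" "D v" "D w"
  shows "b (\<phi> u) (\<phi> v) w = - b u v w"
proof -
  have swap: "b x y z = b y x z" if "D x" "D y" "D z" for x y z
    using b_minus_b[of x y z] that by (simp add: a_zero)
  have sym: "b x y z = b x z y" for x y z
    using M_sym[of x y z] by (simp add: G_sym)
  have "b (\<phi> u) (\<phi> v) w = b w (\<phi> u) (\<phi> v)"
    using sym swap assms by (metis G_xi_phi)
  also have "\<dots> = - b w u v"
    using b_phi_phi[of w u v] assms by (simp add: a_zero)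
  finally show ?thesis using sym swap assms by metis
qed

text \<open>As \<phi> is skew, only pairings with \<open>\<phi> w\<close> occur; these vectors lie
  in D, where the terms in \<open>N\<close> vanish and \<open>b_phi_phi_left\<close>
  applies.\<close>

lemma phi_nabla_s:
  assumes "D u" "D v"
  shows "\<phi> ((M (\<phi> u) (\<phi> v) - N (\<phi> u) (\<phi> v)) + (M u v - N u v)) = 0"
proof (rule G_eqI)
  show "G (\<phi> ((M (\<phi> u) (\<phi> v) - N (\<phi> u) (\<phi> v)) + (M u v - N u v))) w = G 0 w" for w
    using assms b_phi_phi_left[of u v "\<phi> w"] by (simp add: phi_skew a_zero)
qed

text \<open>The trace over the frame is that over its image under \<open>\<phi>\<close>, up to the value at \<open>(\<xi>, \<xi>)\<close>; by
  \<open>phi_nabla_s\<close> these have opposite \<open>\<D>\<close>-parts.\<close>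

lemma trace_nabla_s:
  assumes e: "\<And>i j. i < DIM('e) \<Longrightarrow> j < DIM('e) \<Longrightarrow> G (e i) (e j) = (if i = j then 1 else 0)"
  shows "- (\<Sum>i<DIM('e). M (e i) (e i) - N (e i) (e i)) = (\<Sum>i<DIM('e). G (s (e i)) (s (e i))) *\<^sub>R \<xi>"
proof -
  let ?I = "{..<DIM('e)}"
  define \<beta> where "\<beta> u v = \<phi> (M u v - N u v)" for u v
  have bil: "bilinear \<beta>"
    by (auto simp: \<beta>_def bilinear_def linear_iff algebra_simps)
  have \<beta>_xi: "\<beta> \<xi> \<xi> = 0"
    by (simp add: \<beta>_def M_xi_right)
  have tr: "(\<Sum>i\<in>?I. B (\<phi> (e i)) (\<phi> (e i))) = (\<Sum>i\<in>?I. B (e i) (e i)) - B \<xi> \<xi>"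
    if B: "bilinear B" for B :: "'e \<Rightarrow> 'e \<Rightarrow> 'e"
  proof -
    note exp = G_orthonormal_expansion[where e=e, OF e]
    have expB: "B u v = (\<Sum>j\<in>?I. \<Sum>k\<in>?I. (G u (e j) * G v (e k)) *\<^sub>R B (e j) (e k))" for u v
    proof -
      have "B u v = B (\<Sum>j\<in>?I. G u (e j) *\<^sub>R e j) (\<Sum>k\<in>?I. G v (e k) *\<^sub>R e k)"
        using exp by metis
      also have "\<dots> = (\<Sum>(j, k)\<in>?I \<times> ?I. B (G u (e j) *\<^sub>R e j) (G v (e k) *\<^sub>R e k))"
        by (rule bilinear_sum[OF B])
      finally show ?thesis
        by (simp add: sum.cartesian_product bilinear_lmul[OF B] bilinear_rmul[OF B] mult.commute)
    qed
    \<comment> \<open>After \<phi> is moved off \<open>e i\<close> by skewness, this is Parseval's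
      identity for \<open>\<phi> (e j)\<close> and \<open>\<phi> (e k)\<close>, evaluated with
      \<open>phi_compat\<close>.\<close>
    have c: "(\<Sum>i\<in>?I. G (\<phi> (e i)) (e j) * G (\<phi> (e i)) (e k)) =
        (if j = k then 1 else 0) - G \<xi> (e j) * G \<xi> (e k)" if jk: "j \<in> ?I" "k \<in> ?I" for j k
    proof -
      have "(\<Sum>i\<in>?I. G (\<phi> (e i)) (e j) * G (\<phi> (e i)) (e k)) =
          (\<Sum>i\<in>?I. G (G (\<phi> (e j)) (e i) *\<^sub>R e i) (\<phi> (e k)))"
      proof (intro sum.cong refl)
        fix i
        have "G (\<phi> (e i)) (e j) = - G (\<phi> (e j)) (e i)" by (metis phi_skew G_sym)
        then show "G (\<phi> (e i)) (e j) * G (\<phi> (e i)) (e k) = G (G (\<phi> (e j)) (e i) *\<^sub>R e i) (\<phi> (e k))"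
          by (simp add: phi_skew[of "e i" "e k"])
      qed
      also have "\<dots> = G (\<Sum>i\<in>?I. G (\<phi> (e j)) (e i) *\<^sub>R e i) (\<phi> (e k))"
        using G_bilinear unfolding bilinear_def by (simp add: linear_sum[of "\<lambda>u. G u (\<phi> (e k))"])
      also have "\<dots> = G (\<phi> (e j)) (\<phi> (e k))"
        using exp by metis
      finally show ?thesis using jk by (simp add: phi_compat e)
    qed
    have "(\<Sum>i\<in>?I. B (\<phi> (e i)) (\<phi> (e i))) =
        (\<Sum>i\<in>?I. \<Sum>j\<in>?I. \<Sum>k\<in>?I. (G (\<phi> (e i)) (e j) * G (\<phi> (e i)) (e k)) *\<^sub>R B (e j) (e k))"
      by (intro sum.cong refl) (rule expB)
    also have "\<dots> = (\<Sum>j\<in>?I. \<Sum>i\<in>?I. \<Sum>k\<in>?I. (G (\<phi> (e i)) (e j) * G (\<phi> (e i)) (e k)) *\<^sub>R B (e j) (e k))"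
      by (rule sum.swap)
    also have "\<dots> = (\<Sum>j\<in>?I. \<Sum>k\<in>?I. \<Sum>i\<in>?I. (G (\<phi> (e i)) (e j) * G (\<phi> (e i)) (e k)) *\<^sub>R B (e j) (e k))"
      by (rule sum.cong[OF refl sum.swap])
    also have "\<dots> = (\<Sum>j\<in>?I. \<Sum>k\<in>?I. ((if j = k then 1 else 0) - G \<xi> (e j) * G \<xi> (e k)) *\<^sub>R B (e j) (e k))"
      by (intro sum.cong refl) (simp add: c flip: scaleR_left.sum)
    also have "\<dots> = (\<Sum>j\<in>?I. \<Sum>k\<in>?I. (if j = k then B (e j) (e k) else 0)) -
        (\<Sum>j\<in>?I. \<Sum>k\<in>?I. (G \<xi> (e j) * G \<xi> (e k)) *\<^sub>R B (e j) (e k))"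
      unfolding sum_subtractf[symmetric] by (intro sum.cong refl) (auto simp: algebra_simps)
    also have "\<dots> = (\<Sum>j\<in>?I. B (e j) (e j)) - B \<xi> \<xi>"
      by (simp add: expB[of \<xi> \<xi>])
    finally show ?thesis .
  qed
  \<comment> \<open>\<open>phi_nabla_s\<close> requires arguments in D, which the \<open>e i\<close>
    need not be; \<open>C\<close> evaluates \<beta> on their images under \<phi>.\<close>
  define C where "C u v = \<beta> (\<phi> u) (\<phi> v)" for u v
  have bilC: "bilinear C"
    by (auto simp: C_def bilinear_def linear_iff bilinear_ladd[OF bil] bilinear_radd[OF bil]
        bilinear_lmul[OF bil] bilinear_rmul[OF bil])
  have "(\<Sum>i\<in>?I. C (e i) (e i)) + (\<Sum>i\<in>?I. C (\<phi> (e i)) (\<phi> (e i))) = 0"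
    unfolding sum.distrib[symmetric]
  proof (intro sum.neutral ballI)
    fix i
    show "C (e i) (e i) + C (\<phi> (e i)) (\<phi> (e i)) = 0"
      using phi_nabla_s[of "\<phi> (e i)" "\<phi> (e i)"] unfolding C_def \<beta>_def phi_simps by (simp add: add.commute)
  qed
  moreover have "(\<Sum>i\<in>?I. C (\<phi> (e i)) (\<phi> (e i))) = (\<Sum>i\<in>?I. C (e i) (e i))"
    using tr[OF bilC] by (simp add: C_def bilinear_lzero[OF bil])
  moreover have "(\<Sum>i\<in>?I. C (e i) (e i)) = (\<Sum>i\<in>?I. \<beta> (e i) (e i))"
    using tr[OF bil] by (simp add: C_def \<beta>_xi)
  ultimately have "2 *\<^sub>R (\<Sum>i\<in>?I. \<beta> (e i) (e i)) = 0" by (simp add: scaleR_2)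
  then have 0: "\<phi> (\<Sum>i\<in>?I. M (e i) (e i) - N (e i) (e i)) = 0"
    unfolding \<beta>_def linear_sum[OF phi_linear] by simp
  have "G \<xi> (\<Sum>i\<in>?I. M (e i) (e i) - N (e i) (e i)) = (\<Sum>i\<in>?I. G (M (e i) (e i) - N (e i) (e i)) \<xi>)"
    using G_bilinear unfolding bilinear_def by (simp add: linear_sum[of "G \<xi>"] G_sym)
  then have "G \<xi> (\<Sum>i\<in>?I. M (e i) (e i) - N (e i) (e i)) = - (\<Sum>i\<in>?I. G (s (e i)) (s (e i)))"
    by (simp only: G_nabla_s_xi sum_negf)
  \<comment> \<open>The trace is killed by \<phi>, so \<open>phi_phi\<close> identifies it with its
    \<xi>-component.\<close>
  with phi_phi[of "\<Sum>i\<in>?I. M (e i) (e i) - N (e i) (e i)"] 0 show ?thesis by simp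
qed

end

section \<open>Vector fields and endomorphism fields on a framed open set\<close>

locale framed_contact = smooth_mfd A
  for A :: "('a::topological_space, 'e::euclidean_space) chart set" +
  fixes \<phi> :: "'a \<Rightarrow> 'e \<Rightarrow> 'e" and \<xi> :: "('a, 'e) vfield" and \<eta> :: "'a \<Rightarrow> 'e \<Rightarrow> real"
    and g :: "'a \<Rightarrow> 'e \<Rightarrow> 'e \<Rightarrow> real" and nab :: "('a, 'e) conn"
    and W :: "'a set" and E :: "nat \<Rightarrow> ('a, 'e) vfield"
  assumes contact: "contact_metric A \<phi> \<xi> \<eta> g"
    and levi_civita: "levi_civita A g nab"
    and W: "open_in_mfd A W"
    and frame: "orthonormal_frame A g W E"
begin

abbreviation V :: "('a, 'e) vfield \<Rightarrow> bool" where "V \<equiv> smooth_vf A W"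
abbreviation F :: "('a \<Rightarrow> real) \<Rightarrow> bool" where "F \<equiv> smooth_fun A W"

lemma W_mcarrier: "p \<in> W \<Longrightarrow> p \<in> mcarrier A"
  using W by (auto simp: open_in_mfd_def)

lemma almost_contact: "almost_contact_metric A \<phi> \<xi> \<eta> g"
  using contact by (simp add: contact_metric_def)

lemma acm_space: "p \<in> W \<Longrightarrow> acm_space (g p) (\<phi> p) (\<xi> p)"
  using almost_contact W_mcarrier[of p]
  unfolding almost_contact_metric_def riemannian_metric_def endo_field_def
  by (intro acm_space.intro) auto

lemma eta: "p \<in> W \<Longrightarrow> \<eta> p v = g p (\<xi> p) v"
  using almost_contact W_mcarrier[of p] by (simp add: almost_contact_metric_def)

lemma V_xi: "V \<xi>"
  using almost_contact W smooth_vf_subset[of "mcarrier A" \<xi> W]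
  by (simp add: almost_contact_metric_def open_in_mfd_def)

lemma V_phi: "V X \<Longrightarrow> V (\<lambda>q. \<phi> q (X q))"
  using almost_contact W by (simp add: almost_contact_metric_def endo_field_def)

lemma F_g: "V X \<Longrightarrow> V Y \<Longrightarrow> F (\<lambda>q. g q (X q) (Y q))"
  using almost_contact W by (simp add: almost_contact_metric_def riemannian_metric_def)

lemma connection: "connection A nab"
  using levi_civita by (simp add: levi_civita_def)

lemma V_nab: "V X \<Longrightarrow> V Y \<Longrightarrow> V (nab X Y)"
  using connection W by (simp add: connection_def)

lemma V_frame: "i < DIM('e) \<Longrightarrow> V (E i)"
  using frame by (simp add: orthonormal_frame_def)

lemma frame_orthonormal:
  "p \<in> W \<Longrightarrow> i < DIM('e) \<Longrightarrow> j < DIM('e) \<Longrightarrow> g p (E i p) (E j p) = (if i = j then 1 else 0)"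
  using frame by (simp add: orthonormal_frame_def)

lemma frame_expansion: "p \<in> W \<Longrightarrow> v = (\<Sum>i<DIM('e). g p v (E i p) *\<^sub>R E i p)"
  using acm_space.G_orthonormal_expansion[OF acm_space, where e="\<lambda>i. E i p"] frame_orthonormal
  by blast

lemmas V_add = smooth_vf_add[OF W]
lemmas V_scaleR = smooth_vf_scaleR[OF W]
lemmas V_const_scaleR = V_scaleR[OF smooth_fun_const]
lemmas V_cong = smooth_vf_cong[OF W]

lemma V_0: "V (\<lambda>q. 0)"
  using V_const_scaleR[OF V_xi, of 0] by simp

lemma V_minus: "V X \<Longrightarrow> V (\<lambda>q. - X q)"
  using V_const_scaleR[of X "-1"] by simp

lemma V_diff: "V X \<Longrightarrow> V Y \<Longrightarrow> V (\<lambda>q. X q - Y q)"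
  using V_add[OF _ V_minus, of X Y] by simp

lemma V_sum: "(\<And>i. i \<in> I \<Longrightarrow> V (X i)) \<Longrightarrow> V (\<lambda>q. \<Sum>i\<in>I. X i q)"
  by (induction I rule: infinite_finite_induct) (simp_all add: V_0 V_add)

text \<open>Constant combinations of the frame fields extend any vector over \<open>W\<close>
  without bump functions. Through this, identities between fields become identities between vectors
  at \<open>p\<close>.\<close>

lemma vector_extension:
  assumes "p \<in> W"
  obtains X where "V X" "X p = v"
proof
  show "V (\<lambda>q. \<Sum>i<DIM('e). g p v (E i p) *\<^sub>R E i q)"
    by (intro V_sum V_const_scaleR V_frame) simp
  show "(\<Sum>i<DIM('e). g p v (E i p) *\<^sub>R E i p) = v"
    using frame_expansion[OF assms] by metis
qed

lemma nab_add_left: "V X \<Longrightarrow> V Y \<Longrightarrow> V Z \<Longrightarrow> p \<in> W \<Longrightarrow> nab (\<lambda>q. X q + Y q) Z p = nab X Z p + nab Y Z p"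
  and nab_add: "V X \<Longrightarrow> V Y \<Longrightarrow> V Z \<Longrightarrow> p \<in> W \<Longrightarrow> nab X (\<lambda>q. Y q + Z q) p = nab X Y p + nab X Z p"
  and nab_scaleR_left: "F f \<Longrightarrow> V X \<Longrightarrow> V Y \<Longrightarrow> p \<in> W \<Longrightarrow> nab (\<lambda>q. f q *\<^sub>R X q) Y p = f p *\<^sub>R nab X Y p"
  and nab_scaleR: "F f \<Longrightarrow> V X \<Longrightarrow> V Y \<Longrightarrow> p \<in> W \<Longrightarrow>
    nab X (\<lambda>q. f q *\<^sub>R Y q) p = dir_deriv A X f p *\<^sub>R Y p + f p *\<^sub>R nab X Y p"
  using connection W by (simp_all add: connection_def)

lemma nab_const_scaleR: "V X \<Longrightarrow> V Y \<Longrightarrow> p \<in> W \<Longrightarrow> nab X (\<lambda>q. r *\<^sub>R Y q) p = r *\<^sub>R nab X Y p"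
  by (simp add: nab_scaleR smooth_fun_const)

lemma nab_0: "V X \<Longrightarrow> p \<in> W \<Longrightarrow> nab X (\<lambda>q. 0) p = 0"
  using nab_const_scaleR[OF _ V_xi, of X p 0] by simp

lemma nab_minus: "V X \<Longrightarrow> V Y \<Longrightarrow> p \<in> W \<Longrightarrow> nab X (\<lambda>q. - Y q) p = - nab X Y p"
  using nab_const_scaleR[of X Y p "-1"] by simp

text \<open>Smoothness on \<open>W\<close> ignores values elsewhere. Multiplication by this function
  fixes a field that vanishes on \<open>W\<close>, and so forces operators satisfying a product rule
  to give zero on it.\<close>

lemma F_off_W: "F (\<lambda>q. if q \<in> W then 0 else 1)"
  by (rule smooth_fun_cong[OF W smooth_fun_const[of W 0]]) simp

lemma nab_local:
  assumes X: "V X" "V Y" "V Y'" and eq: "\<And>q. q \<in> W \<Longrightarrow> Y q = Y' q" and p: "p \<in> W"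
  shows "nab X Y p = nab X Y' p"
proof -
  define Z where "Z q = Y q - Y' q" for q
  have Z: "V Z" unfolding Z_def using X by (intro V_diff)
  have "Z = (\<lambda>q. (if q \<in> W then 0 else 1) *\<^sub>R Z q)"
    by (rule ext) (simp add: Z_def eq)
  then have "nab X Z p = nab X (\<lambda>q. (if q \<in> W then 0 else 1) *\<^sub>R Z q) p" by metis
  also have "\<dots> = 0"
    using nab_scaleR[OF F_off_W X(1) Z p] p by (simp add: Z_def eq)
  finally have "nab X Z p = 0" .
  moreover have "nab X (\<lambda>q. Y' q + Z q) p = nab X Y' p + nab X Z p"
    by (rule nab_add[OF X(1,3) Z p])
  ultimately show ?thesis by (simp add: Z_def)
qed

section \<open>Tensoriality and pointwise values of covariant derivatives\<close>

definition tensorial :: "'a \<Rightarrow> (('a, 'e) vfield \<Rightarrow> 'b::real_vector) \<Rightarrow> bool" where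
  "tensorial p P \<longleftrightarrow>
    (\<forall>X Y. V X \<longrightarrow> V Y \<longrightarrow> P (\<lambda>q. X q + Y q) = P X + P Y) \<and>
    (\<forall>f X. F f \<longrightarrow> V X \<longrightarrow> P (\<lambda>q. f q *\<^sub>R X q) = f p *\<^sub>R P X)"

lemma tensorial_local:
  assumes P: "tensorial p P" and p: "p \<in> W" and X: "V X" "V Y"
    and eq: "\<And>q. q \<in> W \<Longrightarrow> X q = Y q"
  shows "P X = P Y"
proof -
  define Z where "Z q = X q - Y q" for q
  have Z: "V Z" unfolding Z_def using X by (intro V_diff)
  have "Z = (\<lambda>q. (if q \<in> W then 0 else 1) *\<^sub>R Z q)"
    by (rule ext) (simp add: Z_def eq)
  then have "P Z = P (\<lambda>q. (if q \<in> W then 0 else 1) *\<^sub>R Z q)" by metis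
  also have "\<dots> = (if p \<in> W then 0 else 1) *\<^sub>R P Z"
    using P F_off_W Z unfolding tensorial_def by blast
  finally have "P Z = 0" using p by simp
  moreover have "P (\<lambda>q. Y q + Z q) = P Y + P Z"
    using P X Z unfolding tensorial_def by blast
  ultimately show ?thesis by (simp add: Z_def)
qed

lemma tensorial_sum:
  assumes P: "tensorial p P" and "finite I" "\<And>i. i \<in> I \<Longrightarrow> F (f i)" "\<And>i. i \<in> I \<Longrightarrow> V (X i)"
  shows "P (\<lambda>q. \<Sum>i\<in>I. f i q *\<^sub>R X i q) = (\<Sum>i\<in>I. f i p *\<^sub>R P (X i))"
  using assms(2-)
proof (induction I rule: finite_induct)
  case empty
  have "P (\<lambda>q. 0 *\<^sub>R \<xi> q) = 0 *\<^sub>R P \<xi>"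
    using P V_xi smooth_fun_const unfolding tensorial_def by blast
  then show ?case by simp
next
  case (insert i I)
  have "P (\<lambda>q. f i q *\<^sub>R X i q + (\<Sum>i\<in>I. f i q *\<^sub>R X i q)) =
      P (\<lambda>q. f i q *\<^sub>R X i q) + P (\<lambda>q. \<Sum>i\<in>I. f i q *\<^sub>R X i q)"
    using P V_scaleR[OF insert.prems] V_sum[of I "\<lambda>i q. f i q *\<^sub>R X i q"] insert.prems
    unfolding tensorial_def by (simp add: V_scaleR)
  moreover have "P (\<lambda>q. f i q *\<^sub>R X i q) = f i p *\<^sub>R P (X i)"
    using P insert.prems unfolding tensorial_def by blast
  ultimately show ?case using insert by simp
qed

lemma tensorial_frame:
  assumes P: "tensorial p P" and p: "p \<in> W" and X: "V X"
  shows "P X = (\<Sum>i<DIM('e). g p (X p) (E i p) *\<^sub>R P (E i))"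
proof -
  have "P X = P (\<lambda>q. \<Sum>i<DIM('e). g q (X q) (E i q) *\<^sub>R E i q)"
    using X by (intro tensorial_local[OF P p] V_sum V_scaleR F_g V_frame frame_expansion) auto
  also have "\<dots> = (\<Sum>i<DIM('e). g p (X p) (E i p) *\<^sub>R P (E i))"
    using X by (intro tensorial_sum[OF P] F_g V_frame) auto
  finally show ?thesis .
qed

lemma tensorial_nab: "V Y \<Longrightarrow> p \<in> W \<Longrightarrow> tensorial p (\<lambda>X. nab X Y p)"
  by (simp add: tensorial_def nab_add_left nab_scaleR_left)

text \<open>The endomorphism taking v to the derivative of \<xi> in the direction v. The connection
  accepts only fields, so it is assembled from the frame; \<open>nab_xi\<close> confirms the
  meaning.\<close>

definition s :: "'a \<Rightarrow> 'e \<Rightarrow> 'e" where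
  "s p v = (\<Sum>i<DIM('e). g p v (E i p) *\<^sub>R nab (E i) \<xi> p)"

lemma nab_xi: "V X \<Longrightarrow> p \<in> W \<Longrightarrow> nab X \<xi> p = s p (X p)"
  unfolding s_def by (rule tensorial_frame[OF tensorial_nab[OF V_xi]])

lemma linear_g_left: "p \<in> W \<Longrightarrow> linear (\<lambda>u. g p u v)"
  using acm_space.G_bilinear[OF acm_space] by (simp add: bilinear_def)

lemma linear_s: "p \<in> W \<Longrightarrow> linear (s p)"
  by (rule linearI) (simp_all add: s_def linear_add[OF linear_g_left] linear_scale[OF linear_g_left]
      scaleR_add_left sum.distrib scaleR_sum_right)

definition endo :: "('a \<Rightarrow> 'e \<Rightarrow> 'e) \<Rightarrow> bool" where
  "endo T \<longleftrightarrow> (\<forall>p\<in>W. linear (T p)) \<and> (\<forall>X. V X \<longrightarrow> V (\<lambda>q. T q (X q)))"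

lemma endo_linear: "endo T \<Longrightarrow> p \<in> W \<Longrightarrow> linear (T p)"
  and endo_V: "endo T \<Longrightarrow> V X \<Longrightarrow> V (\<lambda>q. T q (X q))"
  by (simp_all add: endo_def)

lemma endo_phi: "endo \<phi>"
  using acm_space.phi_linear[OF acm_space] V_phi by (simp add: endo_def)

lemma endo_s: "endo s"
  unfolding endo_def using linear_s V_cong[OF V_nab[OF _ V_xi] nab_xi] by blast

definition \<sigma> :: "'a \<Rightarrow> 'e \<Rightarrow> 'e" where "\<sigma> p v = s p v + \<phi> p v"

lemma endo_sigma: "endo \<sigma>"
  unfolding endo_def \<sigma>_def[abs_def]
  using endo_s endo_phi by (auto simp: endo_def intro!: linear_compose_add V_add)

definition nab_endo :: "('a \<Rightarrow> 'e \<Rightarrow> 'e) \<Rightarrow> ('a, 'e) vfield \<Rightarrow> ('a, 'e) vfield \<Rightarrow> 'a \<Rightarrow> 'e" where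
  "nab_endo T X Y p = nab X (\<lambda>q. T q (Y q)) p - T p (nab X Y p)"

lemma tensorial_nab_endo_left:
  assumes "endo T" "V Y" "p \<in> W"
  shows "tensorial p (\<lambda>X. nab_endo T X Y p)"
  using assms endo_V[OF assms(1,2)]
  by (simp add: tensorial_def nab_endo_def nab_add_left nab_scaleR_left algebra_simps
      linear_add[OF endo_linear] linear_scale[OF endo_linear])

lemma tensorial_nab_endo:
  assumes T: "endo T" and X: "V X" and p: "p \<in> W"
  shows "tensorial p (\<lambda>Y. nab_endo T X Y p)"
proof -
  note lin = endo_linear[OF T] and TV = endo_V[OF T]
  \<comment> \<open>\<open>T q\<close> is known to be linear only for \<open>q\<close> in
    \<open>W\<close>, so the two fields may differ elsewhere and \<open>nab_local\<close> is
    needed.\<close>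
  have "nab X (\<lambda>q. T q (Y q + Z q)) p = nab X (\<lambda>q. T q (Y q) + T q (Z q)) p"
    if "V Y" "V Z" for Y Z
    using that by (intro nab_local X TV V_add p) (simp_all add: linear_add[OF lin])
  moreover have "nab X (\<lambda>q. T q (f q *\<^sub>R Y q)) p = nab X (\<lambda>q. f q *\<^sub>R T q (Y q)) p"
    if "V Y" "F f" for Y f
    using that by (intro nab_local X TV V_scaleR p) (simp_all add: linear_scale[OF lin])
  ultimately show ?thesis
    using X p by (simp add: tensorial_def nab_endo_def nab_add nab_scaleR TV
        linear_add[OF lin[OF p]] linear_scale[OF lin[OF p]] algebra_simps)
qed

text \<open>The covariant derivative of \<open>T\<close> as a bilinear map of tangent vectors:
  direction first, argument of \<open>T\<close> second.\<close>

definition deriv_endo :: "('a \<Rightarrow> 'e \<Rightarrow> 'e) \<Rightarrow> 'a \<Rightarrow> 'e \<Rightarrow> 'e \<Rightarrow> 'e" where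
  "deriv_endo T p u v = (\<Sum>i<DIM('e). \<Sum>j<DIM('e).
    (g p u (E i p) * g p v (E j p)) *\<^sub>R nab_endo T (E i) (E j) p)"

lemma bilinear_deriv_endo: "p \<in> W \<Longrightarrow> bilinear (deriv_endo T p)"
  unfolding bilinear_def
  by (auto intro!: linearI simp: deriv_endo_def linear_add[OF linear_g_left] linear_scale[OF linear_g_left]
      scaleR_add_left sum.distrib scaleR_sum_right distrib_left distrib_right mult_ac)

lemma nab_endo:
  assumes T: "endo T" and X: "V X" and Y: "V Y" and p: "p \<in> W"
  shows "nab_endo T X Y p = deriv_endo T p (X p) (Y p)"
proof -
  have "nab_endo T X Y p = (\<Sum>i<DIM('e). g p (X p) (E i p) *\<^sub>R nab_endo T (E i) Y p)"
    by (rule tensorial_frame[OF tensorial_nab_endo_left[OF T Y p] p X])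
  also have "\<dots> = (\<Sum>i<DIM('e). g p (X p) (E i p) *\<^sub>R
      (\<Sum>j<DIM('e). g p (Y p) (E j p) *\<^sub>R nab_endo T (E i) (E j) p))"
    by (intro sum.cong refl arg_cong2[of _ _ _ _ scaleR])
      (use tensorial_frame[OF tensorial_nab_endo[OF T V_frame p] p Y] in simp)
  finally show ?thesis by (simp add: deriv_endo_def scaleR_sum_right)
qed

section \<open>Contact metric structures satisfying the nullity condition\<close>

lemma nab_diff: "V X \<Longrightarrow> V Y \<Longrightarrow> V Z \<Longrightarrow> p \<in> W \<Longrightarrow>
    nab X (\<lambda>q. Y q - Z q) p = nab X Y p - nab X Z p"
  using nab_add[OF _ _ V_minus, of X Y Z p] by (simp add: nab_minus)

lemma dir_deriv_g: "V X \<Longrightarrow> V Y \<Longrightarrow> V Z \<Longrightarrow> p \<in> W \<Longrightarrow>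
    dir_deriv A X (\<lambda>q. g q (Y q) (Z q)) p = g p (nab X Y p) (Z p) + g p (Y p) (nab X Z p)"
  and torsion_free: "V X \<Longrightarrow> V Y \<Longrightarrow> p \<in> W \<Longrightarrow> lie_bracket A X Y p = nab X Y p - nab Y X p"
  using levi_civita W by (simp_all add: levi_civita_def)

lemma dir_deriv_g_cong:
  assumes "V X" "V Y" "V Z" "V Y'" "V Z'" "p \<in> W"
    and eq: "\<And>q. q \<in> W \<Longrightarrow> g q (Y q) (Z q) = g q (Y' q) (Z' q)"
  shows "g p (nab X Y p) (Z p) + g p (Y p) (nab X Z p) =
    g p (nab X Y' p) (Z' p) + g p (Y' p) (nab X Z' p)"
  using dir_deriv_cong[OF W F_g[of Y Z] eq assms(6), where X=X] assms by (simp add: dir_deriv_g)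

lemma dir_deriv_eta:
  assumes "V X" "V Y" "p \<in> W"
  shows "dir_deriv A X (\<lambda>q. \<eta> q (Y q)) p = g p (s p (X p)) (Y p) + g p (\<xi> p) (nab X Y p)"
  using dir_deriv_cong[OF W F_g[OF V_xi assms(2)] _ assms(3), of "\<lambda>q. \<eta> q (Y q)" X]
    dir_deriv_g[OF assms(1) V_xi assms(2,3)] assms by (simp add: eta nab_xi)

lemma contact_form:
  "V X \<Longrightarrow> V Y \<Longrightarrow> p \<in> W \<Longrightarrow> ext_deriv A \<eta> X Y p = g p (X p) (\<phi> p (Y p))"
  using contact W by (simp add: contact_metric_def)

text \<open>In d\<eta>(X, Y), expressed through the connection, the derivatives of X and Y cancel
  against the bracket because there is no torsion; twice the antisymmetric part of \<nabla>\<xi>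
  remains.\<close>

lemma s_skew:
  assumes p: "p \<in> W"
  shows "g p (s p u) v - g p (s p v) u = 2 * g p u (\<phi> p v)"
proof -
  interpret acm_space "g p" "\<phi> p" "\<xi> p" by (rule acm_space[OF p])
  obtain X Y where "V X" "V Y" "X p = u" "Y p = v" using vector_extension[OF p] by metis
  then show ?thesis
    using contact_form[of X Y p] p
    by (simp add: ext_deriv_def dir_deriv_eta torsion_free eta)
qed

lemma g_xi_s:
  assumes p: "p \<in> W"
  shows "g p (\<xi> p) (s p u) = 0"
proof -
  interpret acm_space "g p" "\<phi> p" "\<xi> p" by (rule acm_space[OF p])
  obtain X where X: "V X" "X p = u" using vector_extension[OF p] by metis
  have "dir_deriv A X (\<lambda>q. g q (\<xi> q) (\<xi> q)) p = dir_deriv A X (\<lambda>q. 1) p"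
    using acm_space.xi_unit[OF acm_space] by (intro dir_deriv_cong[OF W F_g[OF V_xi V_xi] _ p])
  then show ?thesis
    using X p dir_deriv_g[OF X(1) V_xi V_xi p] by (simp add: nab_xi G_sym)
qed

text \<open>The derivative of the adjointness relation. The factor \<open>r\<close> covers the skew
  \<phi> (r = -1) and the symmetric \<sigma> (r = 1) at once.\<close>

lemma deriv_endo_adjoint:
  assumes T: "endo T" and adj: "\<And>q u v. q \<in> W \<Longrightarrow> g q (T q u) v = r * g q u (T q v)" and p: "p \<in> W"
  shows "g p (deriv_endo T p u v) w = r * g p v (deriv_endo T p u w)"
proof -
  interpret acm_space "g p" "\<phi> p" "\<xi> p" by (rule acm_space[OF p])
  obtain X Y Z where V: "V X" "V Y" "V Z" and eq: "X p = u" "Y p = v" "Z p = w"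
    using vector_extension[OF p] by metis
  note TV = endo_V[OF T]
  have "g p (nab X (\<lambda>q. T q (Y q)) p) (Z p) + g p (T p (Y p)) (nab X Z p) =
      g p (nab X Y p) (r *\<^sub>R T p (Z p)) + g p (Y p) (nab X (\<lambda>q. r *\<^sub>R T q (Z q)) p)"
  proof (rule dir_deriv_g_cong)
    fix q assume q: "q \<in> W"
    interpret q: acm_space "g q" "\<phi> q" "\<xi> q" by (rule acm_space[OF q])
    show "g q (T q (Y q)) (Z q) = g q (Y q) (r *\<^sub>R T q (Z q))" using adj[OF q] by simp
  qed (rule V TV[OF V(2)] V_const_scaleR[OF TV[OF V(3)]] p)+
  moreover have "nab X (\<lambda>q. T q (Y q)) p = deriv_endo T p u v + T p (nab X Y p)"
    "nab X (\<lambda>q. T q (Z q)) p = deriv_endo T p u w + T p (nab X Z p)"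
    using nab_endo[OF T V(1,2) p] nab_endo[OF T V(1,3) p] eq by (simp_all add: nab_endo_def diff_eq_eq)
  ultimately show ?thesis
    by (simp add: nab_const_scaleR V TV p adj eq algebra_simps)
qed

lemma deriv_phi_skew: "p \<in> W \<Longrightarrow> g p (deriv_endo \<phi> p u v) w = - g p v (deriv_endo \<phi> p u w)"
  using deriv_endo_adjoint[OF endo_phi, of "-1"] acm_space.phi_skew[OF acm_space] by simp

text \<open>The derivative of the identity for the square of \<phi>; the right-hand side is the
  derivative of the tensor product of \<eta> and \<xi>.\<close>

lemma deriv_phi_phi:
  assumes p: "p \<in> W"
  shows "deriv_endo \<phi> p u (\<phi> p v) + \<phi> p (deriv_endo \<phi> p u v) =
    g p (s p u) v *\<^sub>R \<xi> p + g p (\<xi> p) v *\<^sub>R s p u"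
proof -
  interpret acm_space "g p" "\<phi> p" "\<xi> p" by (rule acm_space[OF p])
  obtain X Y where V: "V X" "V Y" and eq: "X p = u" "Y p = v"
    using vector_extension[OF p] by metis
  have "nab X (\<lambda>q. \<phi> q (\<phi> q (Y q))) p = nab X (\<lambda>q. g q (\<xi> q) (Y q) *\<^sub>R \<xi> q - Y q) p"
    using V p acm_space.phi_phi[OF acm_space]
    by (intro nab_local V_phi V_diff V_scaleR F_g V_xi) auto
  also have "\<dots> = - nab X Y p + (g p (s p u) v + g p (\<xi> p) (nab X Y p)) *\<^sub>R \<xi> p + g p (\<xi> p) v *\<^sub>R s p u"
    using V p eq by (simp add: nab_diff nab_scaleR V_scaleR F_g V_xi dir_deriv_g nab_xi)
  finally show ?thesis
    using nab_endo[OF endo_phi V(1,2) p] nab_endo[OF endo_phi V(1) V_phi[OF V(2)] p] eq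
    by (simp add: nab_endo_def phi_phi algebra_simps)
qed

text \<open>For coordinate vector fields all brackets vanish, so that \<open>d\<Phi> = d(d\<eta>) = 0\<close> reduces to the
  symmetry of second partial derivatives.\<close>

lemma deriv_phi_cyclic_chart:
  assumes c: "c \<in> A" "W \<subseteq> dom_of c" and p: "p \<in> W"
  shows "g p (deriv_endo \<phi> p u v) w + g p (deriv_endo \<phi> p v w) u + g p (deriv_endo \<phi> p w u) v = 0"
proof -
  interpret acm_space "g p" "\<phi> p" "\<xi> p" by (rule acm_space[OF p])
  have pc: "p \<in> dom_of c" using c p by auto
  obtain x y z where xyz: "coord_vf c x p = u" "coord_vf c y p = v" "coord_vf c z p = w"
    using coord_vf_surj[OF c(1) pc] by metis
  let ?X = "coord_vf c"
  define S where "S = map_of_chart c ` W"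
  have S_eq: "S = map_of_chart c ` (dom_of c \<inter> W)" using c by (auto simp: S_def)
  have S: "open S" "map_of_chart c p \<in> S"
    using open_chart_image[OF c(1), of W] W p unfolding S_eq[symmetric] by (auto simp: open_in_mfd_def S_def)
  have V: "V (?X a)" for a using c W by (intro smooth_coord_vf)
  define f where "f a = (\<lambda>q. g q (\<xi> q) (?X a q))" for a
  have Ff: "F (f a)" for a unfolding f_def by (intro F_g V_xi V)
  \<comment> \<open>The coordinate expression of \<eta> on a field with constant components
    \<open>a\<close>; \<open>H\<close> collects its second derivatives.\<close>
  define k where "k a = f a \<circ> chart_inv c" for a
  have smk: "smooth_on S (k a)" for a
    using Ff[of a] c(1) unfolding smooth_fun_def k_def S_eq by blast
  define H where "H a b d = frechet_derivative (\<lambda>t. frechet_derivative (k a) (at t) b) (at (map_of_chart c p)) d" for a b d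
  have H_sym: "H a b d = H a d b" for a b d
    unfolding H_def by (rule second_derivative_symmetric[OF S smk])
  have bracket: "nab (?X a) (?X b) q = nab (?X b) (?X a) q" if "q \<in> W" for a b q
    using torsion_free[OF V V that, of a b] lie_bracket_coord_vf[OF c(1), of q a b] c that by auto
  have dk: "dir_deriv A (?X a) (\<lambda>q. \<eta> q (?X b q)) q = frechet_derivative (k b) (at (map_of_chart c q)) a"
    if q: "q \<in> W" for a b q
  proof -
    have "dir_deriv A (?X a) (f b) q = dir_deriv A (?X a) (\<lambda>q. \<eta> q (?X b q)) q"
      using q eta by (intro dir_deriv_cong[OF W Ff]) (simp_all add: f_def)
    then show ?thesis using dir_deriv_coord_vf[OF W Ff q c(1)] c q by (auto simp: k_def)
  qed
  have \<Phi>: "g q (?X a q) (\<phi> q (?X b q)) = (1/2) * (frechet_derivative (k b) (at (map_of_chart c q)) a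
      - frechet_derivative (k a) (at (map_of_chart c q)) b)" if q: "q \<in> W" for a b q
  proof -
    interpret q: acm_space "g q" "\<phi> q" "\<xi> q" by (rule acm_space[OF q])
    show ?thesis
      using contact_form[OF V V q, of a b] lie_bracket_coord_vf[OF c(1), of q a b] c q
      by (auto simp: ext_deriv_def dk eta)
  qed
  have d\<Phi>: "dir_deriv A (?X d) (\<lambda>q. g q (?X a q) (\<phi> q (?X b q))) p = (1/2) * (H b a d - H a b d)" for a b d
  proof -
    let ?h = "\<lambda>t. (1/2) * (frechet_derivative (k b) (at t) a - frechet_derivative (k a) (at t) b)"
    let ?G = "\<lambda>q. g q (?X a q) (\<phi> q (?X b q))"
    have "((\<lambda>t. (1/2) * (frechet_derivative (k b) (at t) a - frechet_derivative (k a) (at t) b)) has_derivative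
        (\<lambda>d. (1/2) * (H b a d - H a b d))) (at (map_of_chart c p))"
      unfolding H_def
      using smooth_on_differentiable[OF smooth_on_frechet_derivative[OF smk] S(2)]
      by (intro has_derivative_mult_right has_derivative_diff) (simp_all add: frechet_derivative_works)
    then have "((?G \<circ> chart_inv c) has_derivative (\<lambda>d. (1/2) * (H b a d - H a b d))) (at (map_of_chart c p))"
    proof (rule has_derivative_transform_within_open[OF _ S])
      fix t assume "t \<in> S"
      then obtain q where "q \<in> W" "q \<in> dom_of c" "t = map_of_chart c q" using c by (auto simp: S_def)
      then show "?h t = (?G \<circ> chart_inv c) t" using c(1) by (simp add: \<Phi>)
    qed
    then have "frechet_derivative (?G \<circ> chart_inv c) (at (map_of_chart c p)) d = (1/2) * (H b a d - H a b d)"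
      by (simp flip: frechet_derivative_at)
    moreover have "F ?G" by (intro F_g V_phi V)
    ultimately show ?thesis using dir_deriv_coord_vf[OF W _ p c(1) pc] by simp
  qed
  \<comment> \<open>Metric compatibility splits the derivative of \<Phi>. In the cyclic sum the two
    connection terms cancel in pairs, since \<open>bracket\<close> makes the derivative of one
    coordinate field along another symmetric.\<close>
  have N: "dir_deriv A (?X d) (\<lambda>q. g q (?X a q) (\<phi> q (?X b q))) p =
      g p (nab (?X d) (?X a) p) (\<phi> p (?X b p)) - g p (nab (?X d) (?X b) p) (\<phi> p (?X a p))
      - g p (deriv_endo \<phi> p (?X d p) (?X a p)) (?X b p)" for a b d
    using diff_eq_eq[THEN iffD1, OF nab_endo[OF endo_phi V V p, of d b, unfolded nab_endo_def]] deriv_phi_skew[OF p, of "?X d p" "?X a p" "?X b p"]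
      phi_skew[of "?X a p" "nab (?X d) (?X b) p"] G_sym[of "nab (?X d) (?X b) p" "\<phi> p (?X a p)"]
    by (simp add: dir_deriv_g V V_phi p)
  have "(1/2) * (H z y x - H y z x) + (1/2) * (H x z y - H z x y) + (1/2) * (H y x z - H x y z) = 0"
    using H_sym[of z y x] H_sym[of y z x] H_sym[of x z y] by (simp add: diff_divide_distrib)
  then show ?thesis
    unfolding d\<Phi>[symmetric] N
    using bracket[OF p, of x y] bracket[OF p, of y z] bracket[OF p, of z x] by (simp add: xyz)
qed

lemma framed_contact_subset:
  assumes "open_in_mfd A W'" "W' \<subseteq> W"
  shows "framed_contact A \<phi> \<xi> \<eta> g nab W' E"
  using assms contact levi_civita frame smooth_vf_subset atlas
  by unfold_locales (auto simp: orthonormal_frame_def)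

text \<open>The identity is local. \<open>deriv_endo\<close> is built from \<open>E\<close>,
  \<open>g\<close> and \<open>nab\<close> without reference to \<open>W\<close>, so shrinking
  \<open>W\<close> into a chart domain does not change it.\<close>

lemma deriv_phi_cyclic:
  assumes p: "p \<in> W"
  shows "g p (deriv_endo \<phi> p u v) w + g p (deriv_endo \<phi> p v w) u + g p (deriv_endo \<phi> p w u) v = 0"
proof -
  obtain c where c: "c \<in> A" "p \<in> dom_of c" using chart_at[OF W_mcarrier[OF p]] by blast
  interpret r: framed_contact A \<phi> \<xi> \<eta> g nab "W \<inter> dom_of c" E
    using W c open_dom by (intro framed_contact_subset) (auto simp: open_in_mfd_def open_Int)
  show ?thesis by (rule r.deriv_phi_cyclic_chart[OF c(1)]) (use c p in auto)
qed

lemma contact_jet: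
  assumes p: "p \<in> W"
  shows "contact_jet (g p) (\<phi> p) (\<xi> p) (s p) (\<sigma> p) (deriv_endo \<phi> p)"
  by (intro contact_jet.intro acm_space p contact_jet_axioms.intro linear_s s_skew g_xi_s
      bilinear_deriv_endo deriv_phi_skew deriv_phi_phi deriv_phi_cyclic) (simp add: \<sigma>_def)

lemma deriv_sigma_sym:
  assumes p: "p \<in> W"
  shows "g p (deriv_endo \<sigma> p u v) w = g p v (deriv_endo \<sigma> p u w)"
proof -
  have "g p (deriv_endo \<sigma> p u v) w = 1 * g p v (deriv_endo \<sigma> p u w)"
    using contact_jet.sigma_sym[OF contact_jet] by (intro deriv_endo_adjoint[OF endo_sigma _ p]) simp
  then show ?thesis by simp
qed

lemma deriv_sigma_xi:
  assumes p: "p \<in> W"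
  shows "deriv_endo \<sigma> p u (\<xi> p) = - \<sigma> p (s p u)"
proof -
  obtain X where X: "V X" "X p = u" using vector_extension[OF p] by metis
  have "nab X (\<lambda>q. \<sigma> q (\<xi> q)) p = nab X (\<lambda>q. 0) p"
    using X p contact_jet.sigma_xi[OF contact_jet]
    by (intro nab_local endo_V[OF endo_sigma] V_xi V_0) auto
  then show ?thesis
    using nab_endo[OF endo_sigma X(1) V_xi p] X p by (simp add: nab_endo_def nab_0 nab_xi)
qed

lemma deriv_sigma_phi:
  assumes p: "p \<in> W"
  shows "deriv_endo \<phi> p u (\<sigma> p v) + \<phi> p (deriv_endo \<sigma> p u v) + deriv_endo \<sigma> p u (\<phi> p v) +
    \<sigma> p (deriv_endo \<phi> p u v) = 0"
proof -
  interpret contact_jet "g p" "\<phi> p" "\<xi> p" "s p" "\<sigma> p" "deriv_endo \<phi> p" by (rule contact_jet[OF p])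
  obtain X Y where V: "V X" "V Y" and eq: "X p = u" "Y p = v"
    using vector_extension[OF p] by metis
  note \<sigma>V = endo_V[OF endo_sigma]
  note d = nab_endo[OF endo_phi V p] nab_endo[OF endo_sigma V p]
    nab_endo[OF endo_phi V(1) \<sigma>V[OF V(2)] p] nab_endo[OF endo_sigma V(1) V_phi[OF V(2)] p]
  have "nab X (\<lambda>q. \<sigma> q (\<phi> q (Y q))) p = nab X (\<lambda>q. - \<phi> q (\<sigma> q (Y q))) p"
    using contact_jet.sigma_phi[OF contact_jet] V p by (intro nab_local V_minus \<sigma>V V_phi) auto
  then have "nab X (\<lambda>q. \<sigma> q (\<phi> q (Y q))) p = - nab X (\<lambda>q. \<phi> q (\<sigma> q (Y q))) p"
    using V p by (simp add: nab_minus V_phi \<sigma>V)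
  then show ?thesis
    by (simp add: d[symmetric, unfolded eq] nab_endo_def sigma_phi)
qed

section \<open>The second derivative of \<xi> and the tensor h\<close>

lemma nab_endo_s:
  assumes "V X" "V Y" "p \<in> W"
  shows "nab_endo s X Y p = deriv_endo \<sigma> p (X p) (Y p) - deriv_endo \<phi> p (X p) (Y p)"
proof -
  have "nab X (\<lambda>q. \<sigma> q (Y q)) p = nab X (\<lambda>q. s q (Y q)) p + nab X (\<lambda>q. \<phi> q (Y q)) p"
    using assms by (simp add: \<sigma>_def nab_add endo_V[OF endo_s] V_phi)
  then show ?thesis
    using assms by (simp add: nab_endo[OF endo_phi, symmetric] nab_endo[OF endo_sigma, symmetric] nab_endo_def)
      (simp add: \<sigma>_def)
qed

text \<open>The second covariant derivative of \<xi> is the covariant derivative of the endomorphism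
  field \<open>s\<close>, and s = \<sigma> - \<phi>.\<close>

lemma nab2_xi:
  assumes "V X" "V Y" "p \<in> W"
  shows "nab2 nab X Y \<xi> p = deriv_endo \<sigma> p (X p) (Y p) - deriv_endo \<phi> p (X p) (Y p)"
proof -
  have "nab X (nab Y \<xi>) p = nab X (\<lambda>q. s q (Y q)) p"
    using assms by (intro nab_local V_nab V_xi endo_V[OF endo_s] nab_xi)
  then show ?thesis
    using assms by (simp add: nab2_def nab_xi V_nab nab_endo_s[symmetric] nab_endo_def)
qed

text \<open>Writing the brackets in the Lie derivative without torsion leaves the derivative of
  \<phi> along \<xi> and the commutator of \<phi> with \<nabla>\<xi>.\<close>

lemma h_field:
  assumes "V X" "p \<in> W"
  shows "h_field A \<phi> \<xi> X p =
    (1/2) *\<^sub>R (deriv_endo \<phi> p (\<xi> p) (X p) - s p (\<phi> p (X p)) + \<phi> p (s p (X p)))"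
  using assms
  by (simp add: h_field_def lie_deriv_endo_def torsion_free V_xi V_phi nab_xi
      nab_endo[OF endo_phi V_xi, symmetric] nab_endo_def linear_diff[OF endo_linear[OF endo_phi]] algebra_simps)

end

section \<open>From the pointwise identities to harmonicity\<close>

locale framed_nullity = framed_contact A \<phi> \<xi> \<eta> g nab W E
  for A :: "('a::topological_space, 'e::euclidean_space) chart set" and \<phi> \<xi> \<eta> g nab W E +
  fixes \<kappa> \<mu> :: real
  assumes nullity: "nullity_condition A \<phi> \<xi> g nab \<kappa> \<mu>"
begin

lemma contact_nullity_jet:
  assumes p: "p \<in> W"
  shows "contact_nullity_jet (g p) (\<phi> p) (\<xi> p) (s p) (\<sigma> p) (deriv_endo \<phi> p) (deriv_endo \<sigma> p) \<kappa> \<mu>"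
proof (intro contact_nullity_jet.intro contact_nullity_jet_axioms.intro contact_jet p
    bilinear_deriv_endo deriv_sigma_sym deriv_sigma_xi deriv_sigma_phi)
  interpret acm_space "g p" "\<phi> p" "\<xi> p" by (rule acm_space[OF p])
  fix u v
  obtain X Y where V: "V X" "V Y" and eq: "X p = u" "Y p = v"
    using vector_extension[OF p] by metis
  \<comment> \<open>h is given as an operator on fields, so \<open>r_field g X Y \<xi>\<close> must
    be smooth before the pointwise formula \<open>h_field\<close> can be used.\<close>
  have "V (r_field g X Y \<xi>)"
    unfolding r_field_def using V by (intro V_diff V_scaleR F_g V_xi)
  moreover have "curvature nab X Y \<xi> p =
      \<kappa> *\<^sub>R r_field g X Y \<xi> p + \<mu> *\<^sub>R h_field A \<phi> \<xi> (r_field g X Y \<xi>) p"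
    using nullity W V p by (simp add: nullity_condition_def)
  moreover have "r_field g X Y \<xi> p = g p (\<xi> p) v *\<^sub>R u - g p (\<xi> p) u *\<^sub>R v"
    by (simp add: r_field_def eq G_sym)
  ultimately show "deriv_endo \<sigma> p u v - deriv_endo \<phi> p u v - (deriv_endo \<sigma> p v u - deriv_endo \<phi> p v u) =
      \<kappa> *\<^sub>R (g p (\<xi> p) v *\<^sub>R u - g p (\<xi> p) u *\<^sub>R v) +
      (\<mu> / 2) *\<^sub>R (deriv_endo \<phi> p (\<xi> p) (g p (\<xi> p) v *\<^sub>R u - g p (\<xi> p) u *\<^sub>R v) -
        s p (\<phi> p (g p (\<xi> p) v *\<^sub>R u - g p (\<xi> p) u *\<^sub>R v)) +
        \<phi> p (s p (g p (\<xi> p) v *\<^sub>R u - g p (\<xi> p) u *\<^sub>R v)))"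
    using V p by (simp only: h_field curvature_def nab2_xi eq scaleR_scaleR) simp
qed

lemma contact_nullity_jet_flat:
  assumes p: "p \<in> W"
  shows "contact_nullity_jet_flat (g p) (\<phi> p) (\<xi> p) (s p) (\<sigma> p) (deriv_endo \<phi> p) (deriv_endo \<sigma> p) \<kappa> \<mu>"
proof (intro contact_nullity_jet_flat.intro contact_nullity_jet_flat_axioms.intro contact_nullity_jet p)
  fix u v assume k: "\<kappa> = 1"
  obtain X Y where V: "V X" "V Y" and eq: "X p = u" "Y p = v"
    using vector_extension[OF p] by metis
  have z: "\<sigma> q w = 0" if "q \<in> W" for q w
    using contact_nullity_jet.sigma_zero[OF contact_nullity_jet k] that .
  have "nab X (\<lambda>q. \<sigma> q (Y q)) p = nab X (\<lambda>q. 0) p"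
    using V p z by (intro nab_local endo_V[OF endo_sigma] V_0)
  then show "deriv_endo \<sigma> p u v = 0"
    using nab_endo[OF endo_sigma V p] V p eq z by (simp add: nab_endo_def nab_0)
qed

text \<open>By \<open>N_D\<close> the derivative of \<phi>, applied to a section of D, is a multiple
  of \<xi> and disappears under the projection; the projection inside J is harmless because
  \<phi>\<xi> = 0.\<close>

lemma nab_bar_J:
  assumes "V X" "smooth_section_D A \<eta> W Y" "p \<in> W"
  shows "nab_bar_endo \<xi> \<eta> nab X (J_op \<phi>) Y p = 0"
proof -
  interpret contact_nullity_jet_flat "g p" "\<phi> p" "\<xi> p" "s p" "\<sigma> p" "deriv_endo \<phi> p" "deriv_endo \<sigma> p" \<kappa> \<mu>
    by (rule contact_nullity_jet_flat) fact
  have Y: "V Y" "g p (\<xi> p) (Y p) = 0"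
    using assms by (auto simp: smooth_section_D_def eta[symmetric])
  have "nab X (\<lambda>q. \<phi> q (Y q)) p = \<phi> p (nab X Y p) + deriv_endo \<phi> p (X p) (Y p)"
    using nab_endo[OF endo_phi assms(1) Y(1) assms(3)] by (simp add: nab_endo_def diff_eq_eq add.commute)
  then show ?thesis
    using N_D[OF Y(2), of "X p"] \<open>p \<in> W\<close>
    by (simp add: nab_bar_endo_def nab_bar_def J_op_def proj_D_def eta xi_unit)
qed

lemma harmonic:
  assumes p: "p \<in> W"
  shows "tau_xi E g nab \<xi> p + (1/2) *\<^sub>R J_op \<phi> (T_phi E \<phi> \<xi> \<eta> nab) p = 0"
    and "smooth_section_D A \<eta> W Y \<Longrightarrow> tau_J E \<phi> \<xi> \<eta> nab Y p = 0"
proof -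
  interpret contact_nullity_jet_flat "g p" "\<phi> p" "\<xi> p" "s p" "\<sigma> p" "deriv_endo \<phi> p" "deriv_endo \<sigma> p" \<kappa> \<mu>
    by (rule contact_nullity_jet_flat[OF p])
  have "smooth_section_D A \<eta> W (nab (E i) \<xi>)" if "i < DIM('e)" for i
    using that V_frame V_xi V_nab by (auto simp: smooth_section_D_def eta nab_xi g_xi_s)
  then have "T_phi E \<phi> \<xi> \<eta> nab p = 0"
    unfolding T_phi_def using V_frame p by (intro sum.neutral ballI nab_bar_J) auto
  moreover have "tau_xi E g nab \<xi> p = 0"
    using trace_nabla_s[of "\<lambda>i. E i p"] frame_orthonormal[OF p] p
    by (simp add: tau_xi_def rough_laplacian_xi_def norm_sq_nab_xi_def nab2_xi V_frame nab_xi)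
  ultimately show "tau_xi E g nab \<xi> p + (1/2) *\<^sub>R J_op \<phi> (T_phi E \<phi> \<xi> \<eta> nab) p = 0"
    by (simp add: J_op_def)
  \<comment> \<open>The second derivative of J involves \<open>nab_bar \<xi> \<eta> nab X Z\<close>
    as an argument, and \<open>nab_bar_J\<close> applies only to smooth sections of D.\<close>
  have section_nab_bar: "smooth_section_D A \<eta> W (nab_bar \<xi> \<eta> nab X Z)" if "V X" "V Z" for X Z
  proof -
    have "V (\<lambda>q. nab X Z q - g q (\<xi> q) (nab X Z q) *\<^sub>R \<xi> q)"
      using that by (intro V_diff V_scaleR F_g V_xi V_nab)
    then have "V (nab_bar \<xi> \<eta> nab X Z)"
      by (rule V_cong) (simp add: nab_bar_def proj_D_def eta)
    moreover have "\<eta> q (nab_bar \<xi> \<eta> nab X Z q) = 0" if "q \<in> W" for q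
    proof -
      interpret q: acm_space "g q" "\<phi> q" "\<xi> q" by (rule acm_space[OF that])
      show ?thesis using that by (simp add: nab_bar_def proj_D_def eta q.xi_unit)
    qed
    ultimately show ?thesis by (simp add: smooth_section_D_def)
  qed
  have lap: "rough_laplacian_J E \<phi> \<xi> \<eta> nab Z p = 0" if Z: "smooth_section_D A \<eta> W Z" for Z
  proof -
    have "nab_bar2_endo \<xi> \<eta> nab X X (J_op \<phi>) Z p = 0" if X: "V X" for X
    proof -
      let ?Q = "nab_bar_endo \<xi> \<eta> nab X (J_op \<phi>) Z"
      have VZ: "V Z" using Z by (simp add: smooth_section_D_def)
      \<comment> \<open>Differentiating \<open>?Q\<close> requires its vanishing on all of
        \<open>W\<close>, not only at \<open>p\<close>; its values elsewhere are uncontrolled, so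
        \<open>nab_local\<close> compares it with the zero field.\<close>
      have Q0: "?Q q = 0" if "q \<in> W" for q by (rule nab_bar_J[OF X Z that])
      have "V ?Q" by (rule V_cong[OF V_0]) (simp add: Q0)
      then have "nab X ?Q p = 0"
        using nab_local[OF X _ V_0 Q0 p] nab_0[OF X p] by simp
      then have "nab_bar \<xi> \<eta> nab X ?Q p = 0" using p by (simp add: nab_bar_def proj_D_def eta)
      moreover have "nab_bar_endo \<xi> \<eta> nab X (J_op \<phi>) (nab_bar \<xi> \<eta> nab X Z) p = 0"
        by (rule nab_bar_J[OF X section_nab_bar[OF X VZ] p])
      moreover have "nab_bar_endo \<xi> \<eta> nab (nab X X) (J_op \<phi>) Z p = 0"
        by (rule nab_bar_J[OF V_nab[OF X X] Z p])
      ultimately show ?thesis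
        unfolding nab_bar2_endo_def nab_bar_endo_def[of \<xi> \<eta> nab X "nab_bar_endo \<xi> \<eta> nab X (J_op \<phi>)"] by simp
    qed
    then show ?thesis by (simp add: rough_laplacian_J_def V_frame)
  qed
  show "tau_J E \<phi> \<xi> \<eta> nab Y p = 0" if Y: "smooth_section_D A \<eta> W Y"
  proof -
    have "smooth_section_D A \<eta> W (J_op \<phi> Y)"
      using Y V_phi acm_space.G_xi_phi[OF acm_space] by (auto simp: smooth_section_D_def J_op_def eta)
    then show ?thesis by (simp add: tau_J_def J_op_def[of _ "rough_laplacian_J _ _ _ _ _ _"] lap Y)
  qed
qed

end

theorem theorem2p3:
  fixes A :: "('a::{t2_space, second_countable_topology}, 'e::euclidean_space) chart set"
    and \<phi> :: "'a \<Rightarrow> 'e \<Rightarrow> 'e" and \<xi> :: "('a, 'e) vfield" and \<eta> :: "'a \<Rightarrow> 'e \<Rightarrow> real"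
    and g :: "'a \<Rightarrow> 'e \<Rightarrow> 'e \<Rightarrow> real" and nab :: "('a, 'e) conn" and n :: nat
  assumes "smooth_atlas A" and "DIM('e) = 2 * n + 1"
    and "contact_metric A \<phi> \<xi> \<eta> g"
    and "levi_civita A g nab"
    and "\<exists>\<kappa> \<mu>. nullity_condition A \<phi> \<xi> g nab \<kappa> \<mu>"
  shows "harmonic_structure A \<phi> \<xi> \<eta> g nab"
  unfolding harmonic_structure_def
proof (intro allI impI)
  fix W E
  assume W: "open_in_mfd A W" "orthonormal_frame A g W E"
  obtain \<kappa> \<mu> where "nullity_condition A \<phi> \<xi> g nab \<kappa> \<mu>" using assms(5) by blast
  with W assms interpret framed_nullity A \<phi> \<xi> \<eta> g nab W E \<kappa> \<mu>
    by unfold_locales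
  show "(\<forall>p\<in>W. tau_xi E g nab \<xi> p + (1/2) *\<^sub>R J_op \<phi> (T_phi E \<phi> \<xi> \<eta> nab) p = 0) \<and>
      (\<forall>Y. smooth_section_D A \<eta> W Y \<longrightarrow> (\<forall>p\<in>W. tau_J E \<phi> \<xi> \<eta> nab Y p = 0))"
    using harmonic by blast
qed

end
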